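(* Let $p\in(0,1)$. If $p>\frac16$, then $\mathrm{proj}_{(1,1,1)}(\mathcal M_p)$ contains an interval almost surely conditioned on non-extinction. If $p<\frac16$, then $\mathrm{proj}_{(1,1,1)}(\mathcal M_p)$ does not contain an interval almost surely.
   Context: Projection: $\mathrm{proj}_{(1,1,1)}(x,y,z)=x+y+z$. "Interval" means nondegenerate interval. Random Menger sponge: let $T$ be the set of the $20$ vectors obtained from $\{0,\frac13,\frac23\}^3$ by removing the $7$ vectors having at least two coordinates equal to $\frac13$. Let $f_t(x)=\frac13x+t$ on $\mathbb R^3$ for $t\in T$, and $f_{t_1\dots t_n}=f_{t_1}\circ\dots\circ f_{t_n}$. Give each nonempty finite word over $T$ an independent Bernoulli($p$) label, and let $\mathcal E_n\subset T^n$ be the random set of words $t_1\dots t_n$ such that all of $t_1,\ t_1t_2,\dots,\ t_1\dots t_n$ have label $1$. Then $\mathcal M_p:=\bigcap_{n\ge1}\bigcup_{\mathbf t\in\mathcal E_n}f_{\mathbf t}([0,1]^3)$. Non-extinction is the event that $\mathcal E_n\neq\emptyset$ for all $n$; a property holds "almost surely conditioned on non-extinction" if the event that non-extinction occurs and the property fails has probability $0$. *)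

theory Defs
  imports "HOL-Probability.Probability"
begin

definition menger_T :: "(real^3) set" where
  "menger_T = {t. \<forall>i. t $ i \<in> {0, 1/3, 2/3}} - {t. card {i. t $ i = 1/3} \<ge> 2}"

definition menger_map :: "real^3 \<Rightarrow> real^3 \<Rightarrow> real^3" where
  "menger_map t x = (1/3) *\<^sub>R x + t"

definition menger_word_map :: "(real^3) list \<Rightarrow> real^3 \<Rightarrow> real^3" where
  "menger_word_map w = foldr (\<lambda>t g. menger_map t \<circ> g) w id"

definition menger_words :: "(real^3) list set" where
  "menger_words = lists menger_T - {[]}"

text \<open>In the next three definitions \<open>L\<close> is one realisation of the labelling: \<open>L w\<close> means
  that the word \<open>w\<close> has label 1.\<close>

definition retained :: "((real^3) list \<Rightarrow> bool) \<Rightarrow> nat \<Rightarrow> (real^3) list set" where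
  "retained L n = {w \<in> lists menger_T. length w = n \<and> (\<forall>k\<in>{1..n}. L (take k w))}"

definition menger_sponge :: "((real^3) list \<Rightarrow> bool) \<Rightarrow> (real^3) set" where
  "menger_sponge L = (\<Inter>n\<in>{1..}. \<Union>w\<in>retained L n. menger_word_map w ` cbox 0 1)"

definition non_extinction :: "((real^3) list \<Rightarrow> bool) \<Rightarrow> bool" where
  "non_extinction L \<longleftrightarrow> (\<forall>n\<ge>1. retained L n \<noteq> {})"

definition proj111 :: "real^3 \<Rightarrow> real" where
  "proj111 v = v $ 1 + v $ 2 + v $ 3"

definition contains_interval :: "real set \<Rightarrow> bool" where
  "contains_interval S \<longleftrightarrow> (\<exists>I. is_interval I \<and> (\<exists>x\<in>I. \<exists>y\<in>I. x < y) \<and> I \<subseteq> S)"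

end

(* The digit sums 3 * proj t, for t in T, take the values 0,...,6 with multiplicities
   1, 3, 3, 6, 3, 3, 1. Hence f_w([0,1]^3) projects onto three consecutive triadic intervals of
   length 3^-|w|, and the number of words whose first, second or third interval is a given triadic
   interval evolves under passage to one of its thirds by one of three 3 x 3 matrices. All column
   sums of these matrices are at least 6.

   If p > 1/6, then an interval covered many times in each of the three positions has, up to an
   exponentially small error (Hoeffding), descendants that are all covered by exponentially growing
   numbers of words, and a union bound shows that with positive probability it is covered at all
   levels. A fixed point argument for the generating function of the offspring number turns positive
   probability into almost sure coverage of some interval on non-extinction.

   If p < 1/6, then a triadic rational is covered by O((6 + eps)^n) words of level n, so it almost
   surely does not lie in the projection, and the triadic rationals are dense. *)
theory Submission
  imports Defs
begin

subsection \<open>Digit sums and addresses of words\<close>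

text \<open>On \<open>menger_T\<close> three times the projection is already an integer, so the
  floor loses nothing there; it only makes the digit an \<open>int\<close>.\<close>

definition digit_sum :: "real^3 \<Rightarrow> int" where
  "digit_sum t = \<lfloor>3 * proj111 t\<rfloor>"

text \<open>The numerators over 3 of the vectors in T, kept as a list so that counting by digit sum
  reduces to evaluating the length of a filtered list.\<close>

definition digit_triples :: "(int \<times> int \<times> int) list" where
  "digit_triples = filter (\<lambda>(a, b, c). \<not> (a = 1 \<and> b = 1 \<or> a = 1 \<and> c = 1 \<or> b = 1 \<and> c = 1))
     (List.product [0, 1, 2] (List.product [0, 1, 2] [0, 1, 2]))"

lemma digit_triples_eq: "digit_triples =
   [(0, 0, 0), (0, 0, 1), (0, 0, 2), (0, 1, 0), (0, 1, 2),
    (0, 2, 0), (0, 2, 1), (0, 2, 2), (1, 0, 0), (1, 0, 2),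
    (1, 2, 0), (1, 2, 2), (2, 0, 0), (2, 0, 1), (2, 0, 2),
    (2, 1, 0), (2, 1, 2), (2, 2, 0), (2, 2, 1), (2, 2, 2)]"
  by (simp add: digit_triples_def)

definition triple_vec :: "int \<times> int \<times> int \<Rightarrow> real^3" where
  "triple_vec = (\<lambda>(a, b, c). vector [of_int a / 3, of_int b / 3, of_int c / 3])"

lemma inj_triple_vec: "inj triple_vec"
proof (rule injI)
  fix x y :: "int \<times> int \<times> int" assume *: "triple_vec x = triple_vec y"
  have "triple_vec x $ i = triple_vec y $ i" for i by (simp add: *)
  from this[of 1] this[of 2] this[of 3] show "x = y"
    by (auto simp: triple_vec_def split: prod.splits)
qed

lemma menger_T_eq: "menger_T = triple_vec ` set digit_triples"
proof -
  \<comment> \<open>Turns the cardinality condition on coordinates into the pairwise conditions by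
    which \<open>digit_triples\<close> filters.\<close>
  have card3: "card {i::3. P i} = of_bool (P 1) + of_bool (P 2) + of_bool (P 3)" for P
  proof -
    have "card {i::3. P i} = (\<Sum>i\<in>UNIV. of_bool (P i))" by (simp add: of_bool_def sum.If_cases)
    then show ?thesis by (simp only: sum_3)
  qed
  have T: "t \<in> menger_T \<longleftrightarrow> t $ 1 \<in> {0, 1/3, 2/3} \<and> t $ 2 \<in> {0, 1/3, 2/3} \<and> t $ 3 \<in> {0, 1/3, 2/3} \<and>
       \<not> (t $ 1 = 1/3 \<and> t $ 2 = 1/3 \<or> t $ 1 = 1/3 \<and> t $ 3 = 1/3 \<or> t $ 2 = 1/3 \<and> t $ 3 = 1/3)" for t
    unfolding menger_T_def mem_Collect_eq Diff_iff card3 forall_3 by (auto simp del: insert_iff)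
  have D: "(a, b, c) \<in> set digit_triples \<longleftrightarrow> a \<in> {0, 1, 2} \<and> b \<in> {0, 1, 2} \<and> c \<in> {0, 1, 2} \<and>
       \<not> (a = 1 \<and> b = 1 \<or> a = 1 \<and> c = 1 \<or> b = 1 \<and> c = 1)" for a b c
    unfolding digit_triples_def set_filter set_product mem_Collect_eq mem_Sigma_iff list.set prod.case by blast
  show ?thesis
  proof (intro set_eqI iffI)
    fix t assume t: "t \<in> menger_T"
    define f where "f r = (if r = 0 then 0 else if r = 1/3 then 1 else 2 :: int)" for r :: real
    have f: "of_int (f r) = 3 * r" "f r \<in> {0, 1, 2}" "f r = 1 \<longleftrightarrow> r = 1/3" if "r \<in> {0, 1/3, 2/3}" for r
      using that by (auto simp: f_def)
    have "t = triple_vec (f (t $ 1), f (t $ 2), f (t $ 3))"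
      using t[unfolded T] by (simp add: vec_eq_iff forall_3 triple_vec_def f(1) del: insert_iff)
    moreover have "(f (t $ 1), f (t $ 2), f (t $ 3)) \<in> set digit_triples"
      using t[unfolded T] by (simp add: D f(2,3) del: insert_iff)
    ultimately show "t \<in> triple_vec ` set digit_triples" by blast
  next
    fix t assume "t \<in> triple_vec ` set digit_triples"
    then obtain a b c where "t = triple_vec (a, b, c)" "(a, b, c) \<in> set digit_triples" by auto
    then show "t \<in> menger_T" unfolding T D by (auto simp: triple_vec_def)
  qed
qed

lemma finite_menger_T [simp]: "finite menger_T"
  by (simp add: menger_T_eq)

lemma digit_sum_triple_vec: "digit_sum (triple_vec (a, b, c)) = a + b + c"
proof -
  have "3 * proj111 (triple_vec (a, b, c)) = of_int (a + b + c)"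
    by (simp add: proj111_def triple_vec_def)
  then show ?thesis unfolding digit_sum_def by (metis floor_of_int)
qed

lemma of_int_digit_sum: "t \<in> menger_T \<Longrightarrow> of_int (digit_sum t) = 3 * proj111 t"
  unfolding menger_T_eq by (auto simp: digit_sum_triple_vec) (simp add: proj111_def triple_vec_def)

lemma digit_sum_range: "t \<in> menger_T \<Longrightarrow> digit_sum t \<in> {0..6}"
  unfolding menger_T_eq by (auto simp: digit_sum_triple_vec digit_triples_eq)

lemma card_menger_T_filter: "card {t \<in> menger_T. P (digit_sum t)} = length (filter (\<lambda>(a, b, c). P (a + b + c)) digit_triples)"
proof -
  have "{t \<in> menger_T. P (digit_sum t)} = triple_vec ` set (filter (\<lambda>(a, b, c). P (a + b + c)) digit_triples)"
    unfolding menger_T_eq by (force simp: digit_sum_triple_vec)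
  then have "card {t \<in> menger_T. P (digit_sum t)} = card (set (filter (\<lambda>(a, b, c). P (a + b + c)) digit_triples))"
    by (simp add: card_image[OF inj_on_subset[OF inj_triple_vec]])
  also have "\<dots> = length (filter (\<lambda>(a, b, c). P (a + b + c)) digit_triples)"
    by (intro distinct_card distinct_filter) (simp add: digit_triples_eq)
  finally show ?thesis .
qed

lemma card_menger_T: "card menger_T = 20"
  using card_menger_T_filter[of "\<lambda>_. True"] by (simp add: digit_triples_eq)

lemma card_digit_sum:
  "card {t \<in> menger_T. digit_sum t = 0} = 1"
  "card {t \<in> menger_T. digit_sum t = 1} = 3"
  "card {t \<in> menger_T. digit_sum t = 2} = 3"
  "card {t \<in> menger_T. digit_sum t = 3} = 6"
  "card {t \<in> menger_T. digit_sum t = 4} = 3"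
  "card {t \<in> menger_T. digit_sum t = 5} = 3"
  "card {t \<in> menger_T. digit_sum t = 6} = 1"
  using card_menger_T_filter[of "\<lambda>s. s = 0"] card_menger_T_filter[of "\<lambda>s. s = 1"]
    card_menger_T_filter[of "\<lambda>s. s = 2"] card_menger_T_filter[of "\<lambda>s. s = 3"]
    card_menger_T_filter[of "\<lambda>s. s = 4"] card_menger_T_filter[of "\<lambda>s. s = 5"]
    card_menger_T_filter[of "\<lambda>s. s = 6"]
  by (simp_all add: digit_triples_eq)

text \<open>A base-3 number with the digit sums as digits (possibly above 2). The cylinder of a word
  w of length n over T projects onto [\<open>addr w\<close>, \<open>addr w\<close> + 3] scaled by
  3^-n.\<close>

primrec addr :: "(real^3) list \<Rightarrow> int" where
  "addr [] = 0"
| "addr (t # w) = 3 ^ length w * digit_sum t + addr w"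

lemma addr_snoc: "addr (w @ [t]) = 3 * addr w + digit_sum t"
  by (induction w) (auto simp: algebra_simps)

section \<open>Substitution rule for the number of words at each offset\<close>

definition children :: "(real^3) list set \<Rightarrow> (real^3) list set" where
  "children S = (\<lambda>(w, t). w @ [t]) ` (S \<times> menger_T)"

text \<open>For words of one level, offsets 0, 1, 2 mean that the triadic interval with index k is
  the first, second or last third of the projected cylinder; offsets 0 to 3 mean that the closed
  projection contains the triadic point with index k.\<close>

definition at_offset :: "(real^3) list set \<Rightarrow> int \<Rightarrow> int \<Rightarrow> (real^3) list set" where
  "at_offset S k i = {w \<in> S. k - addr w = i}"

lemma finite_children: "finite S \<Longrightarrow> finite (children S)"
  by (simp add: children_def)

lemma finite_at_offset: "finite S \<Longrightarrow> finite (at_offset S k i)"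
  by (simp add: at_offset_def)

text \<open>A child is determined by its parent and last letter, and by \<open>addr_snoc\<close> the
  digit sum j of that letter fixes the address of the parent.\<close>

lemma card_at_offset_children:
  assumes "finite S"
  shows "card (at_offset (children S) K i) =
    (\<Sum>j\<in>{0..6}. card {t \<in> menger_T. digit_sum t = j} * card {w \<in> S. 3 * addr w = K - i - j})"
proof -
  let ?W = "\<lambda>j. {w \<in> S. 3 * addr w = K - i - j}" and ?D = "\<lambda>j. {t \<in> menger_T. digit_sum t = j}"
  have eq: "at_offset (children S) K i = (\<lambda>(w, t). w @ [t]) ` (\<Union>j\<in>{0..6}. ?W j \<times> ?D j)"
  proof (intro set_eqI iffI)
    fix v assume "v \<in> at_offset (children S) K i"
    then obtain w t where *: "v = w @ [t]" "w \<in> S" "t \<in> menger_T" "K - (3 * addr w + digit_sum t) = i"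
      by (auto simp: at_offset_def children_def addr_snoc)
    then have "(w, t) \<in> ?W (digit_sum t) \<times> ?D (digit_sum t)" by auto
    then show "v \<in> (\<lambda>(w, t). w @ [t]) ` (\<Union>j\<in>{0..6}. ?W j \<times> ?D j)"
      using digit_sum_range[OF *(3)] *(1) by (intro image_eqI[of _ _ "(w, t)"]) auto
  qed (auto simp: at_offset_def children_def addr_snoc)
  have "card (at_offset (children S) K i) = card (\<Union>j\<in>{0..6}. ?W j \<times> ?D j)"
    unfolding eq by (rule card_image) (auto simp: inj_on_def)
  also have "\<dots> = (\<Sum>j\<in>{0..6}. card (?W j \<times> ?D j))"
    using assms by (intro card_UN_disjoint) auto
  finally show ?thesis by (simp add: card_cartesian_product mult.commute)
qed

text \<open>The coefficients are the multiplicities of the digit sums 0 to 6. Digit sum j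
  contributes only if i - d + j is a multiple of 3, which is why \<open>col\<close> vanishes
  elsewhere.\<close>

lemma card_at_offset_children_eq:
  fixes S k
  defines "col \<equiv> \<lambda>e. if e mod 3 = 0 then card (at_offset S k (e div 3)) else 0"
  assumes "finite S"
  shows "card (at_offset (children S) (3 * k + d) i) =
    col (i - d) + 3 * col (i - d + 1) + 3 * col (i - d + 2) + 6 * col (i - d + 3)
    + 3 * col (i - d + 4) + 3 * col (i - d + 5) + col (i - d + 6)"
proof -
  have col: "card {w \<in> S. 3 * addr w = 3 * k + d - i - j} = col (i - d + j)" for j
  proof (cases "(i - d + j) mod 3 = 0")
    case True
    then have "3 * addr w = 3 * k + d - i - j \<longleftrightarrow> k - addr w = (i - d + j) div 3" for w by presburger
    with True show ?thesis by (simp add: at_offset_def col_def)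
  next
    case False
    then have "3 * addr w \<noteq> 3 * k + d - i - j" for w by presburger
    with False show ?thesis by (simp add: col_def)
  qed
  have "{0..6} = {0, 1, 2, 3, 4, 5, 6::int}" by auto
  then show ?thesis
    using card_digit_sum unfolding card_at_offset_children[OF assms(2)] col by simp
qed

text \<open>Every column sum of the three \<open>3 \<times> 3\<close> substitution matrices is at least 6.\<close>

lemma card_at_offset_children_ge:
  fixes m :: real
  assumes "finite S" and ge: "\<And>i. i \<in> {0, 1, 2} \<Longrightarrow> m \<le> card (at_offset S k i)"
    and d: "d \<in> {0, 1, 2}" and i: "i \<in> {0, 1, 2}"
  shows "6 * m \<le> card (at_offset (children S) (3 * k + d) i)"
  using d i ge[of 0] ge[of 1] ge[of 2]
  unfolding card_at_offset_children_eq[OF assms(1)] by (elim insertE emptyE; simp)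

text \<open>The case d = 0 follows a fixed triadic point through the levels. Offsets 1 and 2, where
  the point is interior to the projection, form a closed system with all matrix entries 3 and
  leading eigenvalue 6; each end offset is fed by itself and by these two.\<close>

lemma card_boundary_children:
  assumes "finite S"
  shows "card (at_offset (children S) (3 * k) 0) = card (at_offset S k 0) + 6 * card (at_offset S k 1) + card (at_offset S k 2)"
    and "card (at_offset (children S) (3 * k) 1) = 3 * card (at_offset S k 1) + 3 * card (at_offset S k 2)"
    and "card (at_offset (children S) (3 * k) 2) = 3 * card (at_offset S k 1) + 3 * card (at_offset S k 2)"
    and "card (at_offset (children S) (3 * k) 3) = card (at_offset S k 1) + 6 * card (at_offset S k 2) + card (at_offset S k 3)"
  using card_at_offset_children_eq[OF assms, of k 0 0] card_at_offset_children_eq[OF assms, of k 0 1]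
    card_at_offset_children_eq[OF assms, of k 0 2] card_at_offset_children_eq[OF assms, of k 0 3]
  by simp_all

subsection \<open>Retained words and persistently covered intervals\<close>

lemma retained_0 [simp]: "retained L 0 = {[]}"
  by (auto simp: retained_def)

lemma retained_Suc: "retained L (Suc n) = {v \<in> children (retained L n). L v}"
proof (intro set_eqI iffI)
  fix v assume v: "v \<in> retained L (Suc n)"
  then obtain w t where [simp]: "v = w @ [t]" by (cases v rule: rev_cases) (auto simp: retained_def)
  have *: "v \<in> lists menger_T" "length v = Suc n" "\<And>k. k \<in> {1..Suc n} \<Longrightarrow> L (take k v)"
    using v by (auto simp: retained_def)
  have "L (take k w)" if "k \<in> {1..n}" for k
    using *(2) *(3)[of k] that by simp
  then have "w \<in> retained L n"
    using * by (auto simp: retained_def)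
  then show "v \<in> {v \<in> children (retained L n). L v}"
    using * *(3)[of "Suc n"] by (auto simp: children_def)
next
  fix v assume "v \<in> {v \<in> children (retained L n). L v}"
  then obtain w t where [simp]: "v = w @ [t]" and w: "w \<in> retained L n" "t \<in> menger_T" "L v"
    by (auto simp: children_def)
  show "v \<in> retained L (Suc n)"
    using w by (auto simp: retained_def le_Suc_eq)
qed

text \<open>Decomposition at the first letter: the words below t see the shifted labelling
  \<open>\<lambda>w. L (t # w)\<close>, which is the form used by the branching argument.\<close>

lemma Cons_in_retained_iff:
  "t # w \<in> retained L (Suc n) \<longleftrightarrow> t \<in> menger_T \<and> L [t] \<and> w \<in> retained (\<lambda>w. L (t # w)) n"
proof -
  have "(\<forall>k\<in>{1..Suc n}. L (take k (t # w))) \<longleftrightarrow> (\<forall>k\<in>{..n}. L (t # take k w))"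
    by (subst image_Suc_atMost[symmetric]) simp
  also have "\<dots> \<longleftrightarrow> L [t] \<and> (\<forall>k\<in>{1..n}. L (t # take k w))"
    by (subst atMost_atLeast0, subst atLeastAtMost_insertL[symmetric]) auto
  finally show ?thesis by (auto simp: retained_def)
qed

lemma finite_retained [simp]: "finite (retained L n)"
proof (induction n)
  case (Suc n)
  then show ?case by (simp add: retained_Suc finite_children)
qed simp

lemma retained_mono_nonempty: "m \<le> n \<Longrightarrow> retained L n \<noteq> {} \<Longrightarrow> retained L m \<noteq> {}"
  by (induction rule: dec_induct) (auto simp: retained_Suc children_def)

lemma non_extinction_alt: "non_extinction L \<longleftrightarrow> (\<forall>n. retained L n \<noteq> {})"
proof -
  have "retained L 0 \<noteq> {}" by simp
  then show ?thesis unfolding non_extinction_def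
    by (metis One_nat_def Suc_leI neq0_conv)
qed

text \<open>The forward direction is a compactness argument: if the subtree of every retained first
  letter died out, finiteness of T would give a common level N at which all are dead, and level N +
  1 of the whole tree would be empty.\<close>

lemma non_extinction_iff:
  "non_extinction L \<longleftrightarrow> (\<exists>t\<in>menger_T. L [t] \<and> non_extinction (\<lambda>w. L (t # w)))"
proof
  assume L: "non_extinction L"
  show "\<exists>t\<in>menger_T. L [t] \<and> non_extinction (\<lambda>w. L (t # w))"
  proof (rule ccontr)
    assume "\<not> ?thesis"
    then have "\<forall>t\<in>menger_T. \<exists>n. L [t] \<longrightarrow> retained (\<lambda>w. L (t # w)) n = {}"
      by (auto simp: non_extinction_alt)
    then obtain n where n: "\<And>t. t \<in> menger_T \<Longrightarrow> L [t] \<Longrightarrow> retained (\<lambda>w. L (t # w)) (n t) = {}"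
      by metis
    define N where "N = Max (n ` menger_T)"
    have N: "n t \<le> N" if "t \<in> menger_T" for t using that by (simp add: N_def)
    obtain v where v: "v \<in> retained L (Suc N)" using L by (auto simp: non_extinction_alt)
    then obtain t w where [simp]: "v = t # w" by (cases v) (auto simp: retained_def)
    from v have "t \<in> menger_T" "L [t]" "retained (\<lambda>w. L (t # w)) N \<noteq> {}"
      by (auto simp: Cons_in_retained_iff)
    with n N retained_mono_nonempty show False by blast
  qed
next
  assume "\<exists>t\<in>menger_T. L [t] \<and> non_extinction (\<lambda>w. L (t # w))"
  then obtain t where "t \<in> menger_T" "L [t]" and ne: "\<And>n. retained (\<lambda>w. L (t # w)) n \<noteq> {}"
    by (auto simp: non_extinction_alt)
  then have "retained L (Suc n) \<noteq> {}" for n using Cons_in_retained_iff[of t _ L n] ne[of n] by blast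
  then show "non_extinction L" by (auto simp: non_extinction_def Suc_le_eq dest!: gr0_implies_Suc)
qed

definition covered :: "((real^3) list \<Rightarrow> bool) \<Rightarrow> nat \<Rightarrow> int \<Rightarrow> bool" where
  "covered L n k \<longleftrightarrow> (\<exists>w\<in>retained L n. k - addr w \<in> {0, 1, 2})"

text \<open>The \<open>div\<close> condition says that interval \<open>k\<close> of level
  \<open>n\<close> lies inside interval \<open>k\<^sub>0\<close> of level
  \<open>n\<^sub>0\<close>.\<close>

definition persistently_covered :: "((real^3) list \<Rightarrow> bool) \<Rightarrow> nat \<Rightarrow> int \<Rightarrow> bool" where
  "persistently_covered L n\<^sub>0 k\<^sub>0 \<longleftrightarrow> (\<forall>n\<ge>n\<^sub>0. \<forall>k. k div 3 ^ (n - n\<^sub>0) = k\<^sub>0 \<longrightarrow> covered L n k)"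

text \<open>Prefixing t translates all addresses of level m by 3^m times its digit sum, so a
  persistently covered interval of a subtree becomes one of the whole tree, one level
  deeper.\<close>

lemma persistently_covered_Cons:
  assumes t: "t \<in> menger_T" "L [t]" and cov: "persistently_covered (\<lambda>w. L (t # w)) n\<^sub>0 k\<^sub>0"
  shows "persistently_covered L (Suc n\<^sub>0) (k\<^sub>0 + 3 ^ n\<^sub>0 * digit_sum t)"
  unfolding persistently_covered_def
proof (intro allI impI)
  fix n k assume "Suc n\<^sub>0 \<le> n" and k: "k div 3 ^ (n - Suc n\<^sub>0) = k\<^sub>0 + 3 ^ n\<^sub>0 * digit_sum t"
  then obtain m where [simp]: "n = Suc m" and m: "n\<^sub>0 \<le> m" by (cases n) auto
  have "3 ^ m * digit_sum t = 3 ^ (m - n\<^sub>0) * (3 ^ n\<^sub>0 * digit_sum t)"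
    using m by (simp flip: power_add mult.assoc)
  then have "(k - 3 ^ m * digit_sum t) div 3 ^ (m - n\<^sub>0) = (k + 3 ^ (m - n\<^sub>0) * (- (3 ^ n\<^sub>0 * digit_sum t))) div 3 ^ (m - n\<^sub>0)"
    by (simp only: mult_minus_right add_uminus_conv_diff)
  also have "\<dots> = k\<^sub>0" using k by (subst div_mult_self2) auto
  finally have "covered (\<lambda>w. L (t # w)) m (k - 3 ^ m * digit_sum t)"
    using cov m by (auto simp: persistently_covered_def)
  then obtain w where w: "w \<in> retained (\<lambda>w. L (t # w)) m" "k - 3 ^ m * digit_sum t - addr w \<in> {0, 1, 2}"
    by (auto simp: covered_def)
  have "length w = m" using w(1) by (simp add: retained_def)
  then have "t # w \<in> retained L n" "k - addr (t # w) \<in> {0, 1, 2}"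
    using w t by (auto simp: Cons_in_retained_iff algebra_simps)
  then show "covered L n k" unfolding covered_def by blast
qed

lemma persistently_covered_imp_non_extinction:
  assumes "persistently_covered L n\<^sub>0 k\<^sub>0"
  shows "non_extinction L"
  unfolding non_extinction_alt
proof
  fix n
  \<comment> \<open>The leftmost descendant of \<open>k\<^sub>0\<close> at this level is the
    witness.\<close>
  have "covered L (max n n\<^sub>0) (k\<^sub>0 * 3 ^ (max n n\<^sub>0 - n\<^sub>0))"
    using assms unfolding persistently_covered_def by (metis max.cobounded2 nonzero_mult_div_cancel_right power_not_zero zero_neq_numeral)
  then have "retained L (max n n\<^sub>0) \<noteq> {}" by (auto simp: covered_def)
  then show "retained L n \<noteq> {}" by (rule retained_mono_nonempty[rotated]) simp
qed

section \<open>Projected cylinders and intervals in the projected sponge\<close>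

lemma menger_word_map_Nil [simp]: "menger_word_map [] = id"
  and menger_word_map_Cons: "menger_word_map (t # w) = menger_map t \<circ> menger_word_map w"
  by (simp_all add: menger_word_map_def)

lemma menger_word_map_snoc: "menger_word_map (w @ [t]) = menger_word_map w \<circ> menger_map t"
  by (induction w) (simp_all add: menger_word_map_Cons comp_assoc)

lemma proj111_menger_word_map:
  "w \<in> lists menger_T \<Longrightarrow> 3 ^ length w * proj111 (menger_word_map w x) = of_int (addr w) + proj111 x"
proof (induction w)
  case (Cons t w)
  let ?y = "menger_word_map w x"
  have "proj111 (menger_word_map (t # w) x) = proj111 ?y / 3 + proj111 t"
    by (simp add: menger_word_map_Cons menger_map_def proj111_def)
  then have "3 ^ length (t # w) * proj111 (menger_word_map (t # w) x) = 
      3 ^ length w * proj111 ?y + 3 ^ length w * (3 * proj111 t)"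
    by (simp add: algebra_simps)
  also have "3 * proj111 t = of_int (digit_sum t)" using Cons.prems by (simp add: of_int_digit_sum)
  finally show ?case using Cons by simp
qed simp

lemma mem_proj111_cylinder_iff:
  assumes "w \<in> lists menger_T"
  shows "y \<in> proj111 ` menger_word_map w ` cbox 0 1 \<longleftrightarrow> 3 ^ length w * y - of_int (addr w) \<in> {0..3}"
proof
  assume "y \<in> proj111 ` menger_word_map w ` cbox 0 1"
  then obtain x where x: "x \<in> cbox 0 1" "y = proj111 (menger_word_map w x)" by blast
  have bounds: "0 \<le> x $ i \<and> x $ i \<le> 1" for i using x(1) by (auto simp: mem_box_cart)
  have "proj111 x \<in> {0..3}"
    using bounds[of 1] bounds[of 2] bounds[of 3] unfolding proj111_def atLeastAtMost_iff by linarith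
  then show "3 ^ length w * y - of_int (addr w) \<in> {0..3}"
    using proj111_menger_word_map[OF assms, of x] x(2) by simp
next
  define s where "s = 3 ^ length w * y - of_int (addr w)"
  assume "3 ^ length w * y - of_int (addr w) \<in> {0..3}"
  then have s: "s \<in> {0..3}" by (simp add: s_def)
  \<comment> \<open>A point of the main diagonal realises any coordinate sum in [0,3].\<close>
  define x :: "real^3" where "x = (\<chi> i. s / 3)"
  have "x \<in> cbox 0 1" using s by (auto simp: x_def mem_box_cart)
  have "proj111 x = s" by (simp add: proj111_def x_def)
  then have "3 ^ length w * proj111 (menger_word_map w x) = 3 ^ length w * y"
    using proj111_menger_word_map[OF assms, of x] by (simp add: s_def)
  then have "y = proj111 (menger_word_map w x)" by simp
  with \<open>x \<in> cbox 0 1\<close> show "y \<in> proj111 ` menger_word_map w ` cbox 0 1" by blast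
qed

lemma menger_map_cbox: "t \<in> menger_T \<Longrightarrow> x \<in> cbox 0 1 \<Longrightarrow> menger_map t x \<in> cbox 0 1"
proof -
  assume t: "t \<in> menger_T" and x: "x \<in> cbox 0 1"
  have "0 \<le> t $ i \<and> t $ i \<le> 2/3" "0 \<le> x $ i \<and> x $ i \<le> 1" for i
  proof -
    have "t $ i \<in> {0, 1/3, 2/3}" using t unfolding menger_T_def by blast
    then show "0 \<le> t $ i \<and> t $ i \<le> 2/3" by auto
    show "0 \<le> x $ i \<and> x $ i \<le> 1" using x by (auto simp: mem_box_cart)
  qed
  note bounds = this
  show ?thesis unfolding mem_box_cart menger_map_def
  proof
    fix i
    show "0 $ i \<le> ((1 / 3) *\<^sub>R x + t) $ i \<and> ((1 / 3) *\<^sub>R x + t) $ i \<le> 1 $ i"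
      using bounds[of i] by simp
  qed
qed

text \<open>The fibre over a point y of the covered interval meets every finite-level approximation
  \<open>U n\<close>. These intersections are compact and nested, so the fibre contains a point of
  the sponge.\<close>

lemma contains_interval_if_persistently_covered:
  assumes cov: "persistently_covered L n\<^sub>0 k\<^sub>0"
  shows "contains_interval (proj111 ` menger_sponge L)"
proof -
  define U where "U n = (\<Union>w\<in>retained L n. menger_word_map w ` cbox 0 1)" for n
  have sponge: "menger_sponge L = (\<Inter>n\<in>{1..}. U n)" by (simp add: menger_sponge_def U_def)
  have U_Suc: "U (Suc n) \<subseteq> U n" for n
    using menger_map_cbox unfolding U_def by (force simp: retained_Suc children_def menger_word_map_snoc)
  have U_mono: "U n \<subseteq> U m" if "m \<le> n" for m n
    using that lift_Suc_antimono_le[of U, OF U_Suc] by auto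
  have cont_map: "continuous_on S (menger_word_map w)" for S w
  proof (induction w)
    case (Cons t w)
    then show ?case unfolding menger_word_map_Cons
      by (intro continuous_on_compose) (auto simp: menger_map_def intro!: continuous_intros)
  qed (simp add: continuous_on_id')
  have compact_U: "compact (U n)" for n
    unfolding U_def by (intro compact_UN finite_retained compact_continuous_image cont_map compact_cbox)
  have closed_fiber: "closed (proj111 -` {y})" for y
  proof -
    have "continuous_on UNIV proj111" unfolding proj111_def by (intro continuous_intros)
    then show ?thesis by (intro closed_vimage) auto
  qed
  \<comment> \<open>Half-open, so that every y in I has index exactly \<open>k\<^sub>0\<close> at
    level \<open>n\<^sub>0\<close>.\<close>
  define I where "I = {of_int k\<^sub>0 / 3 ^ n\<^sub>0 ..< (of_int k\<^sub>0 + 1) / 3 ^ n\<^sub>0 :: real}"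
  have "y \<in> proj111 ` menger_sponge L" if y: "y \<in> I" for y
  proof -
    have floor0: "\<lfloor>3 ^ n\<^sub>0 * y\<rfloor> = k\<^sub>0"
      using y by (intro floor_unique) (auto simp: I_def field_simps)
    have high: "U n \<inter> proj111 -` {y} \<noteq> {}" if n: "n \<ge> n\<^sub>0" for n
    proof -
      define k where "k = \<lfloor>3 ^ n * y\<rfloor>"
      have "k div 3 ^ (n - n\<^sub>0) = \<lfloor>3 ^ n * y / of_int (3 ^ (n - n\<^sub>0))\<rfloor>"
        unfolding k_def by (rule floor_divide_real_eq_div[symmetric]) simp
      also have "3 ^ n * y / of_int (3 ^ (n - n\<^sub>0)) = 3 ^ n\<^sub>0 * y"
        using power_add[of "3::real" "n - n\<^sub>0" n\<^sub>0] n by (simp add: field_simps)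
      finally have "covered L n k" using floor0 cov n by (auto simp: persistently_covered_def)
      then obtain w where w: "w \<in> retained L n" "k - addr w \<in> {0, 1, 2}" by (auto simp: covered_def)
      have w': "w \<in> lists menger_T" "length w = n" using w(1) by (auto simp: retained_def)
      have "of_int k \<le> 3 ^ n * y" "3 ^ n * y \<le> of_int k + 1" unfolding k_def by linarith+
      moreover have "of_int (k - addr w) \<in> {0..2::real}" using w(2) by auto
      ultimately have "3 ^ length w * y - of_int (addr w) \<in> {0..3}" using w' by auto
      then have "y \<in> proj111 ` menger_word_map w ` cbox 0 1"
        by (subst mem_proj111_cylinder_iff[OF w'(1)])
      then show ?thesis using w(1) unfolding U_def by blast
    qed
    \<comment> \<open>Coverage speaks of levels from \<open>n\<^sub>0\<close> on; lower levels
      follow because the sets \<open>U n\<close> decrease.\<close>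
    have ne: "U n \<inter> proj111 -` {y} \<noteq> {}" for n
      using high[of "max n n\<^sub>0"] U_mono[of n "max n n\<^sub>0"] by fastforce
    have "(\<Inter>n. U n \<inter> proj111 -` {y}) \<noteq> {}"
      using U_mono by (intro compact_nest ne compact_Int_closed compact_U closed_fiber) blast
    then show ?thesis unfolding sponge by blast
  qed
  then have "I \<subseteq> proj111 ` menger_sponge L" by blast
  moreover have "is_interval I" unfolding I_def by (simp add: is_interval_co)
  moreover have "of_int k\<^sub>0 / 3 ^ n\<^sub>0 \<in> I" "(of_int k\<^sub>0 + 1/2) / 3 ^ n\<^sub>0 \<in> I"
    by (simp_all add: I_def divide_strict_right_mono divide_right_mono)
  moreover have "of_int k\<^sub>0 / 3 ^ n\<^sub>0 < (of_int k\<^sub>0 + 1/2 :: real) / 3 ^ n\<^sub>0"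
    by (simp add: divide_strict_right_mono)
  ultimately show ?thesis unfolding contains_interval_def by blast
qed

subsection \<open>Independent labels\<close>

text \<open>Labellings are total functions, while points of the product space are undefined outside
  K. The second conjunct allows passage between a labelling and its restriction to K.\<close>

definition label_pred :: "'w set \<Rightarrow> (('w \<Rightarrow> bool) \<Rightarrow> bool) \<Rightarrow> bool" where
  "label_pred K Q \<longleftrightarrow> Measurable.pred (Pi\<^sub>M K (\<lambda>_. count_space UNIV)) Q \<and>
     (\<forall>L L'. (\<forall>w\<in>K. L w = L' w) \<longrightarrow> Q L = Q L')"

lemma label_pred_cong: "label_pred K Q \<Longrightarrow> (\<And>w. w \<in> K \<Longrightarrow> L w = L' w) \<Longrightarrow> Q L = Q L'"
  unfolding label_pred_def by blast

lemma label_pred_label: "w \<in> K \<Longrightarrow> label_pred K (\<lambda>L. L w)"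
  by (auto simp: label_pred_def)

lemma label_pred_const: "label_pred K (\<lambda>_. b)"
  by (simp add: label_pred_def)

lemma label_pred_not: "label_pred K Q \<Longrightarrow> label_pred K (\<lambda>L. \<not> Q L)"
  unfolding label_pred_def by auto

lemma label_pred_conj: "label_pred K P \<Longrightarrow> label_pred K Q \<Longrightarrow> label_pred K (\<lambda>L. P L \<and> Q L)"
  unfolding label_pred_def by auto

lemma label_pred_imp: "label_pred K P \<Longrightarrow> label_pred K Q \<Longrightarrow> label_pred K (\<lambda>L. P L \<longrightarrow> Q L)"
  unfolding label_pred_def by auto

lemma label_pred_ball: "finite I \<Longrightarrow> (\<And>i. i \<in> I \<Longrightarrow> label_pred K (Q i)) \<Longrightarrow> label_pred K (\<lambda>L. \<forall>i\<in>I. Q i L)"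
  unfolding label_pred_def by (intro conjI pred_intros_finite allI impI ball_cong refl) blast+

lemma label_pred_bex: "finite I \<Longrightarrow> (\<And>i. i \<in> I \<Longrightarrow> label_pred K (Q i)) \<Longrightarrow> label_pred K (\<lambda>L. \<exists>i\<in>I. Q i L)"
  using label_pred_not[OF label_pred_ball[of I K "\<lambda>i L. \<not> Q i L"]] label_pred_not by auto

lemma label_pred_all: "(\<And>i::'i::countable. label_pred K (Q i)) \<Longrightarrow> label_pred K (\<lambda>L. \<forall>i. Q i L)"
  unfolding label_pred_def by (intro conjI pred_intros_countable allI impI iff_allI) blast+

lemma label_pred_ex: "(\<And>i::'i::countable. label_pred K (Q i)) \<Longrightarrow> label_pred K (\<lambda>L. \<exists>i. Q i L)"
  unfolding label_pred_def by (intro conjI pred_intros_countable allI impI iff_exI) blast+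

lemma label_pred_finite:
  assumes "finite K" and dep: "\<And>L L'. (\<And>w. w \<in> K \<Longrightarrow> L w = L' w) \<Longrightarrow> Q L \<Longrightarrow> Q L'"
  shows "label_pred K Q"
proof -
  \<comment> \<open>Q becomes a finite disjunction over the possible sets A of words in K with label
    1.\<close>
  have eq: "Q L \<longleftrightarrow> (\<exists>A\<in>Pow K. (\<forall>w\<in>A. L w) \<and> (\<forall>w\<in>K - A. \<not> L w) \<and> Q (\<lambda>w. w \<in> A))" for L
  proof
    assume "Q L"
    then have "Q (\<lambda>w. w \<in> {w \<in> K. L w})" by (rule dep[rotated]) simp
    then show "\<exists>A\<in>Pow K. (\<forall>w\<in>A. L w) \<and> (\<forall>w\<in>K - A. \<not> L w) \<and> Q (\<lambda>w. w \<in> A)"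
      by (intro bexI[of _ "{w \<in> K. L w}"]) auto
  next
    assume "\<exists>A\<in>Pow K. (\<forall>w\<in>A. L w) \<and> (\<forall>w\<in>K - A. \<not> L w) \<and> Q (\<lambda>w. w \<in> A)"
    then obtain A where "A \<subseteq> K" "\<forall>w\<in>A. L w" "\<forall>w\<in>K - A. \<not> L w" "Q (\<lambda>w. w \<in> A)" by auto
    then show "Q L" by (intro dep[of "\<lambda>w. w \<in> A" L]) auto
  qed
  have "label_pred K (\<lambda>L. \<exists>A\<in>Pow K. (\<forall>w\<in>A. L w) \<and> (\<forall>w\<in>K - A. \<not> L w) \<and> Q (\<lambda>w. w \<in> A))"
    using assms(1) by (intro label_pred_bex label_pred_conj label_pred_ball label_pred_not label_pred_const label_pred_label)
      (auto intro: finite_subset)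
  then show ?thesis by (simp flip: eq)
qed

text \<open>Taking for h the prefixing of a letter expresses that Q holds in the subtree below that
  letter.\<close>

lemma label_pred_vimage:
  fixes K' :: "'b set"
  assumes Q: "label_pred K Q" and h: "\<And>w. w \<in> K \<Longrightarrow> h w \<in> K'"
  shows "label_pred K' (\<lambda>L. Q (\<lambda>w. L (h w)))"
  unfolding label_pred_def
proof (intro conjI allI impI)
  have eq: "Q (\<lambda>w. L (h w)) = Q (\<lambda>w\<in>K. L (h w))" for L
    by (rule label_pred_cong[OF Q]) simp
  have "(\<lambda>L. \<lambda>w\<in>K. L (h w)) \<in> Pi\<^sub>M K' (\<lambda>_. count_space UNIV) \<rightarrow>\<^sub>M Pi\<^sub>M K (\<lambda>_. count_space UNIV)"
    using h by (intro measurable_restrict measurable_component_singleton) auto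
  from measurable_compose[OF this, of Q] Q
  show "Measurable.pred (Pi\<^sub>M K' (\<lambda>_. count_space UNIV)) (\<lambda>L. Q (\<lambda>w. L (h w)))"
    unfolding eq by (auto simp: label_pred_def)
next
  fix L L' :: "'b \<Rightarrow> bool" assume "\<forall>w\<in>K'. L w = L' w"
  then show "Q (\<lambda>w. L (h w)) = Q (\<lambda>w. L' (h w))" using h by (intro label_pred_cong[OF Q]) auto
qed

section \<open>Families of independent Bernoulli labels\<close>

locale iid_labels = prob_space M for M :: "'a measure" +
  fixes X :: "'w \<Rightarrow> 'a \<Rightarrow> bool" and K :: "'w set" and p :: real
  assumes p: "0 < p" "p < 1"
    and indep: "indep_vars (\<lambda>_. count_space UNIV) X K"
    and distr_X: "\<And>w. w \<in> K \<Longrightarrow> distr M (count_space UNIV) (X w) = measure_pmf (bernoulli_pmf p)"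
begin

lemma measurable_X: "w \<in> K \<Longrightarrow> X w \<in> M \<rightarrow>\<^sub>M count_space UNIV"
  using indep by (simp add: indep_vars_def)

lemma measurable_labels:
  assumes "K' \<subseteq> K"
  shows "(\<lambda>\<omega>. \<lambda>w\<in>K'. X w \<omega>) \<in> M \<rightarrow>\<^sub>M Pi\<^sub>M K' (\<lambda>_. count_space UNIV)"
  using assms by (intro measurable_restrict measurable_X) auto

lemma pred_labels:
  assumes "label_pred K' Q" "K' \<subseteq> K"
  shows "Measurable.pred M (\<lambda>\<omega>. Q (\<lambda>w. X w \<omega>))"
proof -
  have "Q (\<lambda>w. X w \<omega>) = Q (\<lambda>w\<in>K'. X w \<omega>)" for \<omega>
    by (rule label_pred_cong[OF assms(1)]) simp
  moreover have "Measurable.pred M (\<lambda>\<omega>. Q (\<lambda>w\<in>K'. X w \<omega>))"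
    using measurable_compose[OF measurable_labels[OF assms(2)], of Q] assms(1) by (auto simp: label_pred_def)
  ultimately show ?thesis by simp
qed

lemma events_labels:
  "label_pred K' Q \<Longrightarrow> K' \<subseteq> K \<Longrightarrow> {\<omega> \<in> space M. Q (\<lambda>w. X w \<omega>)} \<in> events"
  using pred_labels[of K' Q] by simp

text \<open>Grouping independent labels into disjoint blocks keeps them independent, and each event
  is a measurable function of its own block.\<close>

lemma prob_blocks:
  assumes J: "finite J" "J \<noteq> {}" and B: "\<And>j. j \<in> J \<Longrightarrow> B j \<subseteq> K" "disjoint_family_on B J"
    and Q: "\<And>j. j \<in> J \<Longrightarrow> label_pred (B j) (Q j)"
  shows "prob {\<omega> \<in> space M. \<forall>j\<in>J. Q j (\<lambda>w. X w \<omega>)} = (\<Prod>j\<in>J. prob {\<omega> \<in> space M. Q j (\<lambda>w. X w \<omega>)})"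
proof -
  let ?A = "\<lambda>j. {\<omega> \<in> space M. Q j (\<lambda>w\<in>B j. X w \<omega>)}"
  have "indep_events ?A J"
    by (rule indep_eventsI_indep_vars[OF indep_vars_restrict[OF indep B]])
      (use Q in \<open>auto simp: label_pred_def pred_def\<close>)
  then have "prob (\<Inter>j\<in>J. ?A j) = (\<Prod>j\<in>J. prob (?A j))"
    using J by (simp add: indep_events_def)
  moreover have eq: "Q j (\<lambda>w\<in>B j. X w \<omega>) = Q j (\<lambda>w. X w \<omega>)" if "j \<in> J" for j \<omega>
    by (rule label_pred_cong[OF Q[OF that]]) simp
  moreover have "(\<Inter>j\<in>J. ?A j) = {\<omega> \<in> space M. \<forall>j\<in>J. Q j (\<lambda>w. X w \<omega>)}"
    using J eq by auto
  ultimately show ?thesis by simp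
qed

lemma prob_two_blocks:
  assumes "label_pred B P" "label_pred C Q" "B \<subseteq> K" "C \<subseteq> K" "B \<inter> C = {}"
  shows "prob {\<omega> \<in> space M. P (\<lambda>w. X w \<omega>) \<and> Q (\<lambda>w. X w \<omega>)} =
    prob {\<omega> \<in> space M. P (\<lambda>w. X w \<omega>)} * prob {\<omega> \<in> space M. Q (\<lambda>w. X w \<omega>)}"
proof -
  have "prob {\<omega> \<in> space M. \<forall>j\<in>UNIV. (if j then P else Q) (\<lambda>w. X w \<omega>)} =
    (\<Prod>j\<in>UNIV. prob {\<omega> \<in> space M. (if j then P else Q) (\<lambda>w. X w \<omega>)})"
    by (rule prob_blocks[where B = "\<lambda>j. if j then B else C"])
      (use assms in \<open>auto simp: disjoint_family_on_def\<close>)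
  moreover have eq: "(\<forall>j\<in>UNIV. (if j then P else Q) L) \<longleftrightarrow> P L \<and> Q L" for L
    unfolding Ball_def by (metis (full_types) UNIV_I)
  ultimately have "prob {\<omega> \<in> space M. P (\<lambda>w. X w \<omega>) \<and> Q (\<lambda>w. X w \<omega>)} =
    (\<Prod>j\<in>UNIV. prob {\<omega> \<in> space M. (if j then P else Q) (\<lambda>w. X w \<omega>)})"
    unfolding eq by simp
  then show ?thesis by (simp add: UNIV_bool mult.commute)
qed

lemma prob_label:
  assumes "w \<in> K"
  shows "prob {\<omega> \<in> space M. X w \<omega>} = p"
proof -
  have "p = measure (measure_pmf (bernoulli_pmf p)) {True}" using p by (simp add: measure_pmf_single)
  also have "\<dots> = measure (distr M (count_space UNIV) (X w)) {True}" using distr_X[OF assms] by simp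
  also have "\<dots> = prob (X w -` {True} \<inter> space M)"
    using measurable_X[OF assms] by (simp add: measure_distr)
  also have "X w -` {True} \<inter> space M = {\<omega> \<in> space M. X w \<omega>}" by auto
  finally show ?thesis by simp
qed

lemma prob_all_labels:
  assumes "finite W" "W \<subseteq> K"
  shows "prob {\<omega> \<in> space M. \<forall>w\<in>W. X w \<omega>} = p ^ card W"
proof (cases "W = {}")
  case False
  have "prob {\<omega> \<in> space M. \<forall>w\<in>W. X w \<omega>} = (\<Prod>w\<in>W. prob {\<omega> \<in> space M. X w \<omega>})"
    using prob_blocks[of W "\<lambda>w. {w}" "\<lambda>w L. L w"] assms False
    by (auto simp: disjoint_family_on_def label_pred_label)
  also have "\<dots> = (\<Prod>w\<in>W. p)" using assms by (intro prod.cong refl prob_label) auto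
  finally show ?thesis by simp
qed (simp add: prob_space)

text \<open>Hoeffding's inequality for indicators with deviation c times \<open>card W\<close>; the
  quotient in its exponent simplifies. It needs a positive sum of squared ranges, hence the separate
  case of empty W.\<close>

lemma prob_few_labels:
  assumes W: "finite W" "W \<subseteq> K" and c: "0 \<le> c"
  shows "prob {\<omega> \<in> space M. real (card {w \<in> W. X w \<omega>}) \<le> (p - c) * card W} \<le> exp (- 2 * c\<^sup>2 * card W)"
proof (cases "W = {}")
  case False
  interpret Hoeffding_ineq M W "\<lambda>w \<omega>. of_bool (X w \<omega>) :: real" "\<lambda>_. 0" "\<lambda>_. 1"
    "\<Sum>w\<in>W. expectation (\<lambda>\<omega>. of_bool (X w \<omega>) :: real)"
  proof unfold_locales
    show "indep_vars (\<lambda>_. borel) (\<lambda>w \<omega>. of_bool (X w \<omega>) :: real) W"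
      by (rule indep_vars_compose2[OF indep_vars_subset[OF indep W(2)]]) simp
  qed (use W in auto)
  have "expectation (\<lambda>\<omega>. of_bool (X w \<omega>) :: real) = p" if "w \<in> W" for w
  proof -
    have "expectation (\<lambda>\<omega>. of_bool (X w \<omega>) :: real) = expectation (indicator {\<omega> \<in> space M. X w \<omega>})"
      by (rule Bochner_Integration.integral_cong) (auto simp: indicator_def)
    also have "\<dots> = prob ({\<omega> \<in> space M. X w \<omega>} \<inter> space M)" by simp
    also have "{\<omega> \<in> space M. X w \<omega>} \<inter> space M = {\<omega> \<in> space M. X w \<omega>}" by auto
    also have "prob \<dots> = p" using prob_label that W by auto
    finally show ?thesis .
  qed
  then have mu: "(\<Sum>w\<in>W. expectation (\<lambda>\<omega>. of_bool (X w \<omega>) :: real)) = p * card W" by simp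
  have sum: "(\<Sum>w\<in>W. of_bool (X w \<omega>)) = real (card {w \<in> W. X w \<omega>})" for \<omega>
    using W by (simp add: of_bool_def sum.If_cases Int_def)
  have "0 < (\<Sum>w\<in>W. (1 - 0 :: real)\<^sup>2)" using False W by (simp add: card_gt_0_iff)
  from Hoeffding_ineq_le[of "c * card W", OF _ this]
  have "prob {\<omega> \<in> space M. real (card {w \<in> W. X w \<omega>}) \<le> p * card W - c * card W} \<le>
      exp (- 2 * (c * card W)\<^sup>2 / card W)"
    using c unfolding mu sum by simp
  then show ?thesis using False W by (simp add: algebra_simps power2_eq_square)
qed simp

lemma distr_labels:
  assumes "K \<noteq> {}"
  shows "distr M (Pi\<^sub>M K (\<lambda>_. count_space UNIV)) (\<lambda>\<omega>. \<lambda>w\<in>K. X w \<omega>) = Pi\<^sub>M K (\<lambda>_. measure_pmf (bernoulli_pmf p))"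
proof -
  have "distr M (Pi\<^sub>M K (\<lambda>_. count_space UNIV)) (\<lambda>\<omega>. \<lambda>w\<in>K. X w \<omega>) =
      Pi\<^sub>M K (\<lambda>w. distr M (count_space UNIV) (X w))"
    using indep by (subst (asm) indep_vars_iff_distr_eq_PiM'[OF assms measurable_X])
  also have "\<dots> = Pi\<^sub>M K (\<lambda>_. measure_pmf (bernoulli_pmf p))"
    by (intro PiM_cong refl distr_X)
  finally show ?thesis .
qed

lemma prob_labels_eq:
  assumes "K \<noteq> {}" and Q: "label_pred K Q"
  shows "prob {\<omega> \<in> space M. Q (\<lambda>w. X w \<omega>)} =
    measure (Pi\<^sub>M K (\<lambda>_. measure_pmf (bernoulli_pmf p))) {L \<in> space (Pi\<^sub>M K (\<lambda>_. count_space UNIV)). Q L}"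
proof -
  have "measure (distr M (Pi\<^sub>M K (\<lambda>_. count_space UNIV)) (\<lambda>\<omega>. \<lambda>w\<in>K. X w \<omega>))
      {L \<in> space (Pi\<^sub>M K (\<lambda>_. count_space UNIV)). Q L} =
    prob ((\<lambda>\<omega>. \<lambda>w\<in>K. X w \<omega>) -` {L \<in> space (Pi\<^sub>M K (\<lambda>_. count_space UNIV)). Q L} \<inter> space M)"
    using Q by (intro measure_distr measurable_labels) (auto simp: label_pred_def pred_def)
  also have "(\<lambda>\<omega>. \<lambda>w\<in>K. X w \<omega>) -` {L \<in> space (Pi\<^sub>M K (\<lambda>_. count_space UNIV)). Q L} \<inter> space M =
      {\<omega> \<in> space M. Q (\<lambda>w. X w \<omega>)}"
    using label_pred_cong[OF Q, of "\<lambda>w\<in>K. X w _" "\<lambda>w. X w _"] by (auto simp: space_PiM)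
  finally show ?thesis unfolding distr_labels[OF assms(1)] by (rule sym)
qed

lemma iid_labels_reindex:
  assumes "inj_on h K'" "h ` K' \<subseteq> K"
  shows "iid_labels M (\<lambda>w. X (h w)) K' p"
proof
  show "indep_vars (\<lambda>_. count_space UNIV) (\<lambda>w. X (h w)) K'"
  proof -
    have "indep_vars (\<lambda>w. Pi\<^sub>M {h w} (\<lambda>_. count_space UNIV)) (\<lambda>w \<omega>. \<lambda>v\<in>{h w}. X v \<omega>) K'"
      using assms by (intro indep_vars_restrict[OF indep]) (auto simp: disjoint_family_on_def inj_on_def)
    from indep_vars_compose2[OF this, of "\<lambda>w L. L (h w)" "\<lambda>_. count_space UNIV"] show ?thesis by simp
  qed
qed (use p assms distr_X in auto)

text \<open>Probabilities depend only on the joint law, a product of Bernoulli laws preserved by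
  injective relabelling. With h prefixing a letter, this is the self-similarity of the tree in
  law.\<close>

lemma prob_reindex:
  assumes "inj_on h K" "h ` K \<subseteq> K" "label_pred K Q"
  shows "prob {\<omega> \<in> space M. Q (\<lambda>w. X (h w) \<omega>)} = prob {\<omega> \<in> space M. Q (\<lambda>w. X w \<omega>)}"
proof (cases "K = {}")
  case True
  then have "Q (\<lambda>w. X (h w) \<omega>) = Q (\<lambda>w. X w \<omega>)" for \<omega> by (intro label_pred_cong[OF assms(3)]) simp
  then show ?thesis by simp
next
  case False
  interpret h: iid_labels M "\<lambda>w. X (h w)" K p by (rule iid_labels_reindex[OF assms(1,2)])
  show ?thesis using prob_labels_eq[OF False assms(3)] h.prob_labels_eq[OF False assms(3)] by simp
qed

end

subsection \<open>The branching structure\<close>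

definition level_words :: "nat \<Rightarrow> (real^3) list set" where
  "level_words n = {w \<in> lists menger_T. length w = n}"

definition short_words :: "nat \<Rightarrow> (real^3) list set" where
  "short_words n = {w \<in> lists menger_T. length w \<in> {1..n}}"

lemma finite_level_words [simp]: "finite (level_words n)"
proof -
  have "level_words n = {w. set w \<subseteq> menger_T \<and> length w = n}" by (auto simp: level_words_def)
  then show ?thesis by (simp add: finite_lists_length_eq)
qed

lemma finite_short_words [simp]: "finite (short_words n)"
proof -
  have "short_words n = (\<Union>m\<in>{1..n}. level_words m)" by (auto simp: short_words_def level_words_def)
  then show ?thesis by simp
qed

lemma short_words_subset: "short_words n \<subseteq> menger_words"
  and level_words_subset: "0 < n \<Longrightarrow> level_words n \<subseteq> menger_words"
  and short_words_disjoint: "short_words n \<inter> level_words (Suc n) = {}"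
  by (auto simp: short_words_def level_words_def menger_words_def)

lemma retained_subset: "retained L n \<subseteq> level_words n"
  by (auto simp: retained_def level_words_def)

lemma level_words_0 [simp]: "level_words 0 = {[]}"
  by (auto simp: level_words_def)

lemma level_words_Suc: "level_words (Suc n) = children (level_words n)"
  using retained_Suc[of "\<lambda>_. True" n] by (simp add: retained_def level_words_def)

lemma children_subset: "S \<subseteq> level_words n \<Longrightarrow> children S \<subseteq> level_words (Suc n)"
  unfolding level_words_Suc children_def by blast

lemma retained_cong:
  assumes "\<And>w. w \<in> short_words n \<Longrightarrow> L w = L' w"
  shows "retained L n = retained L' n"
proof -
  have "L (take k w) = L' (take k w)" if "w \<in> lists menger_T" "length w = n" "k \<in> {1..n}" for k w
    using that by (intro assms) (auto simp: short_words_def dest: in_set_takeD)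
  then show ?thesis unfolding retained_def by blast
qed

lemma label_pred_mono: "label_pred K Q \<Longrightarrow> K \<subseteq> K' \<Longrightarrow> label_pred K' Q"
  using label_pred_vimage[of K Q "\<lambda>w. w" K'] by auto

lemma label_pred_retained: "label_pred (short_words n) (\<lambda>L. P (retained L n))"
proof (rule label_pred_finite[OF finite_short_words])
  fix L L' :: "(real^3) list \<Rightarrow> bool"
  assume "\<And>w. w \<in> short_words n \<Longrightarrow> L w = L' w" "P (retained L n)"
  then show "P (retained L' n)" using retained_cong[of n L L'] by simp
qed

lemma label_pred_retained': "label_pred menger_words (\<lambda>L. P (retained L n))"
  by (rule label_pred_mono[OF label_pred_retained short_words_subset])

lemma label_pred_non_extinction: "label_pred menger_words non_extinction"
  unfolding non_extinction_alt[abs_def] by (intro label_pred_all label_pred_retained')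

lemma label_pred_persistently_covered:
  "label_pred menger_words (\<lambda>L. \<exists>n\<^sub>0 k\<^sub>0. persistently_covered L n\<^sub>0 k\<^sub>0)"
  unfolding persistently_covered_def covered_def
  by (intro label_pred_ex label_pred_all label_pred_imp label_pred_const label_pred_retained')

text \<open>The map s to (1 - p (1 - s))^n is the generating function of a binomial offspring
  number. If b < a, the geometric sum formula turns the fixed point equation into p times the sum of
  the \<open>f b ^ i\<close> being 1. The sum is strictly larger at a, which contradicts the
  inequality for a.\<close>

lemma branching_fixed_point_le:
  fixes a b p :: real
  assumes p: "0 < p" "p < 1" and n: "2 \<le> n"
    and a: "a \<le> (1 - p * (1 - a)) ^ n" "a < 1" and b: "b = (1 - p * (1 - b)) ^ n" "0 \<le> b"
  shows "a \<le> b"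
proof (rule ccontr)
  assume "\<not> a \<le> b"
  then have ab: "b < a" by simp
  define f where "f s = 1 - p * (1 - s)" for s
  have f: "0 < f b" "f b < f a"
  proof -
    have "f b = (1 - p) + p * b" by (simp add: f_def algebra_simps)
    then show "0 < f b" using p b by (simp add: add_pos_nonneg)
    show "f b < f a" using p ab by (simp add: f_def)
  qed
  have geo: "1 - f s ^ n = p * (1 - s) * (\<Sum>i<n. f s ^ i)" for s
    by (subst one_diff_power_eq) (simp add: f_def)
  have "(1 - b) * (p * (\<Sum>i<n. f b ^ i)) = (1 - b) * 1"
    using geo[of b] b(1) by (simp add: f_def mult_ac)
  then have *: "p * (\<Sum>i<n. f b ^ i) = 1" using ab a by simp
  have "(\<Sum>i<n. f b ^ i) < (\<Sum>i<n. f a ^ i)"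
  proof (rule sum_strict_mono_ex1)
    \<comment> \<open>The term i = 1 increases strictly; this is where 2 \<le> n enters.\<close>
    show "\<exists>i\<in>{..<n}. f b ^ i < f a ^ i" using f n by (intro bexI[of _ 1]) auto
  qed (use f in \<open>auto intro: power_mono\<close>)
  then have "1 < p * (\<Sum>i<n. f a ^ i)" using p * by (metis mult_less_cancel_left_pos)
  then have "1 - a < (1 - a) * (p * (\<Sum>i<n. f a ^ i))" using a by simp
  also have "\<dots> = 1 - f a ^ n" using geo[of a] by (simp add: mult_ac)
  finally show False using a(1) by (simp add: f_def)
qed

section \<open>From positive probability to almost sure coverage on non-extinction\<close>

locale menger_percolation = iid_labels M X menger_words p
  for M :: "'a measure" and X :: "(real^3) list \<Rightarrow> 'a \<Rightarrow> bool" and p :: real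
begin

text \<open>The labels at and below different first letters form disjoint blocks, so 20 factors
  multiply. Within a block the label of \<open>[t]\<close> is independent of those below it, which
  have the law of the whole tree.\<close>

lemma prob_branching:
  assumes Q: "label_pred menger_words Q"
  shows "prob {\<omega> \<in> space M. \<forall>t\<in>menger_T. \<not> (X [t] \<omega> \<and> Q (\<lambda>w. X (t # w) \<omega>))} =
    (1 - p * prob {\<omega> \<in> space M. Q (\<lambda>w. X w \<omega>)}) ^ 20"
proof -
  let ?P = "\<lambda>t L. L [t] \<and> Q (\<lambda>w. L (t # w))"
  let ?B = "\<lambda>t. insert [t] ((#) t ` menger_words)"
  have shift: "label_pred ((#) t ` menger_words) (\<lambda>L. Q (\<lambda>w. L (t # w)))" for t
    by (rule label_pred_vimage[OF Q]) simp
  have P: "label_pred (?B t) (?P t)" for t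
    by (intro label_pred_conj label_pred_label label_pred_mono[OF shift]) auto
  have sub: "(#) t ` menger_words \<subseteq> menger_words" "[t] \<in> menger_words" if "t \<in> menger_T" for t
    using that by (auto simp: menger_words_def)
  have nonempty: "menger_T \<noteq> {}" using card_menger_T by auto
  have "prob {\<omega> \<in> space M. \<forall>t\<in>menger_T. \<not> ?P t (\<lambda>w. X w \<omega>)} =
      (\<Prod>t\<in>menger_T. prob {\<omega> \<in> space M. \<not> ?P t (\<lambda>w. X w \<omega>)})"
    by (rule prob_blocks[OF finite_menger_T nonempty _ _ label_pred_not[OF P]])
      (use sub in \<open>auto simp: disjoint_family_on_def menger_words_def\<close>)
  also have "\<dots> = (\<Prod>t\<in>menger_T. 1 - p * prob {\<omega> \<in> space M. Q (\<lambda>w. X w \<omega>)})"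
  proof (rule prod.cong)
    fix t assume t: "t \<in> menger_T"
    have "prob {\<omega> \<in> space M. X [t] \<omega> \<and> Q (\<lambda>w. X (t # w) \<omega>)} =
        prob {\<omega> \<in> space M. X [t] \<omega>} * prob {\<omega> \<in> space M. Q (\<lambda>w. X (t # w) \<omega>)}"
      by (rule prob_two_blocks[of "{[t]}" "\<lambda>L. L [t]" _ "\<lambda>L. Q (\<lambda>w. L (t # w))", OF _ shift])
        (use sub[OF t] in \<open>auto simp: label_pred_label menger_words_def\<close>)
    also have "\<dots> = p * prob {\<omega> \<in> space M. Q (\<lambda>w. X w \<omega>)}"
      using sub[OF t] by (simp add: prob_label prob_reindex[of "(#) t", OF _ _ Q])
    finally have eq: "prob {\<omega> \<in> space M. ?P t (\<lambda>w. X w \<omega>)} = p * prob {\<omega> \<in> space M. Q (\<lambda>w. X w \<omega>)}" .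
    have "{\<omega> \<in> space M. ?P t (\<lambda>w. X w \<omega>)} \<in> events"
      by (rule events_labels[OF P]) (use sub[OF t] in auto)
    from prob_neg[OF this] show "prob {\<omega> \<in> space M. \<not> ?P t (\<lambda>w. X w \<omega>)} = 1 - p * prob {\<omega> \<in> space M. Q (\<lambda>w. X w \<omega>)}"
      using eq by simp
  qed simp
  finally show ?thesis by (simp add: card_menger_T)
qed

text \<open>Both failure probabilities are governed by the generating function of the offspring
  distribution, which by strict convexity has only one fixed point below 1.\<close>

lemma AE_persistently_covered:
  assumes pos: "0 < prob {\<omega> \<in> space M. \<exists>n\<^sub>0 k\<^sub>0. persistently_covered (\<lambda>w. X w \<omega>) n\<^sub>0 k\<^sub>0}"
  shows "AE \<omega> in M. non_extinction (\<lambda>w. X w \<omega>) \<longrightarrow> (\<exists>n\<^sub>0 k\<^sub>0. persistently_covered (\<lambda>w. X w \<omega>) n\<^sub>0 k\<^sub>0)"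
proof -
  define C where "C L \<longleftrightarrow> (\<exists>n\<^sub>0 k\<^sub>0. persistently_covered L n\<^sub>0 k\<^sub>0)" for L
  have C: "label_pred menger_words C"
    using label_pred_persistently_covered unfolding C_def[abs_def] .
  let ?a = "prob {\<omega> \<in> space M. \<not> C (\<lambda>w. X w \<omega>)}"
  let ?b = "prob {\<omega> \<in> space M. \<not> non_extinction (\<lambda>w. X w \<omega>)}"
  have ev: "{\<omega> \<in> space M. C (\<lambda>w. X w \<omega>)} \<in> events" "{\<omega> \<in> space M. non_extinction (\<lambda>w. X w \<omega>)} \<in> events"
    "{\<omega> \<in> space M. \<not> C (\<lambda>w. X w \<omega>)} \<in> events" "{\<omega> \<in> space M. \<not> non_extinction (\<lambda>w. X w \<omega>)} \<in> events"
    by (rule events_labels[OF C] events_labels[OF label_pred_non_extinction]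
        events_labels[OF label_pred_not[OF C]] events_labels[OF label_pred_not[OF label_pred_non_extinction]], simp)+
  have C_step: "C L" if "t \<in> menger_T" "L [t]" "C (\<lambda>w. L (t # w))" for t L
    using that persistently_covered_Cons unfolding C_def by blast
  have ev': "{\<omega> \<in> space M. \<forall>t\<in>menger_T. \<not> (X [t] \<omega> \<and> C (\<lambda>w. X (t # w) \<omega>))} \<in> events"
  proof (rule events_labels[OF label_pred_ball])
    show "label_pred menger_words (\<lambda>L. \<not> (L [t] \<and> C (\<lambda>w. L (t # w))))" if "t \<in> menger_T" for t
      using that by (intro label_pred_not label_pred_conj label_pred_label label_pred_vimage[OF C])
        (auto simp: menger_words_def)
  qed auto
  \<comment> \<open>Only an inequality: coverage passes from a subtree to the tree, but an interval
    of the tree could be covered jointly by several subtrees.\<close>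
  have "?a \<le> prob {\<omega> \<in> space M. \<forall>t\<in>menger_T. \<not> (X [t] \<omega> \<and> C (\<lambda>w. X (t # w) \<omega>))}"
  proof (rule finite_measure_mono[OF _ ev'], rule Collect_mono)
    fix \<omega>
    show "\<omega> \<in> space M \<and> \<not> C (\<lambda>w. X w \<omega>) \<longrightarrow>
        \<omega> \<in> space M \<and> (\<forall>t\<in>menger_T. \<not> (X [t] \<omega> \<and> C (\<lambda>w. X (t # w) \<omega>)))"
      using C_step[of _ "\<lambda>w. X w \<omega>"] by blast
  qed
  also have "\<dots> = (1 - p * (1 - ?a)) ^ 20"
    using prob_branching[OF C] prob_neg[OF ev(1)] by simp
  finally have a: "?a \<le> (1 - p * (1 - ?a)) ^ 20" .
  have "?b = prob {\<omega> \<in> space M. \<forall>t\<in>menger_T. \<not> (X [t] \<omega> \<and> non_extinction (\<lambda>w. X (t # w) \<omega>))}"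
    by (subst non_extinction_iff) simp
  also have "\<dots> = (1 - p * (1 - ?b)) ^ 20"
    using prob_branching[OF label_pred_non_extinction] prob_neg[OF ev(2)] by simp
  finally have b: "?b = (1 - p * (1 - ?b)) ^ 20" .
  have "?a < 1" using prob_neg[OF ev(1)] pos by (simp add: C_def)
  from branching_fixed_point_le[OF p _ a this b] have ab: "?a \<le> ?b" by simp
  \<comment> \<open>Persistent coverage implies non-extinction, so the subtracted event is contained
    in the other one and has the same probability.\<close>
  have "prob ({\<omega> \<in> space M. \<not> C (\<lambda>w. X w \<omega>)} - {\<omega> \<in> space M. \<not> non_extinction (\<lambda>w. X w \<omega>)}) = ?a - ?b"
    by (rule finite_measure_Diff[OF ev(3,4)])
      (use persistently_covered_imp_non_extinction in \<open>auto simp: C_def\<close>)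
  also have "\<dots> \<le> 0" using ab by simp
  finally have "prob ({\<omega> \<in> space M. \<not> C (\<lambda>w. X w \<omega>)} - {\<omega> \<in> space M. \<not> non_extinction (\<lambda>w. X w \<omega>)}) = 0"
    by (simp add: order_antisym)
  then have "AE \<omega> in M. \<omega> \<notin> {\<omega> \<in> space M. \<not> C (\<lambda>w. X w \<omega>)} - {\<omega> \<in> space M. \<not> non_extinction (\<lambda>w. X w \<omega>)}"
    using ev by (intro AE_not_in) (auto simp: null_sets_def emeasure_eq_measure)
  then show ?thesis by (rule AE_mp) (auto simp: C_def)
qed

end

subsection \<open>The supercritical case\<close>

text \<open>Asking for many words in all three positions makes the property hereditary: the column
  sum bound needs a lower bound at each offset.\<close>

definition rich :: "(real^3) list set \<Rightarrow> int \<Rightarrow> real \<Rightarrow> bool" where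
  "rich S k m \<longleftrightarrow> (\<forall>i\<in>{0, 1, 2}. m \<le> real (card (at_offset S k i)))"

definition descendants :: "nat \<Rightarrow> int \<Rightarrow> int set" where
  "descendants j k = {3 ^ j * k ..< 3 ^ j * (k + 1)}"

lemma mem_descendants_iff: "l \<in> descendants j k \<longleftrightarrow> l div 3 ^ j = k"
proof
  assume "l \<in> descendants j k"
  then show "l div 3 ^ j = k"
    by (intro int_div_pos_eq[where r = "l - 3 ^ j * k"]) (auto simp: descendants_def algebra_simps)
next
  assume k: "l div 3 ^ j = k"
  have "l = 3 ^ j * k + l mod 3 ^ j" using k by (metis mult_div_mod_eq)
  moreover have "0 \<le> l mod 3 ^ j" "l mod 3 ^ j < 3 ^ j" by simp_all
  ultimately have "3 ^ j * k \<le> l" "l < 3 ^ j * k + 3 ^ j" by linarith+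
  then show "l \<in> descendants j k" by (simp add: descendants_def algebra_simps)
qed

lemma finite_descendants [simp]: "finite (descendants j k)"
  and card_descendants: "card (descendants j k) = 3 ^ j"
  by (simp_all add: descendants_def algebra_simps nat_power_eq)

lemma descendants_Suc: "l \<in> descendants (Suc j) k \<Longrightarrow> l div 3 \<in> descendants j k"
  by (simp add: mem_descendants_iff div_mult2_eq[symmetric] mult.commute zdiv_zmult2_eq)

lemma rich_children:
  assumes "finite S" "rich S (l div 3) m"
  shows "rich (children S) l (6 * m)"
proof -
  have "l = 3 * (l div 3) + l mod 3" by simp
  moreover have "l mod 3 \<in> {0, 1, 2}" by auto
  ultimately show ?thesis
    using card_at_offset_children_ge[OF assms(1), of m "l div 3" "l mod 3"] assms(2) by (auto simp: rich_def)
qed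

lemma rich_level_words: "\<exists>k. rich (level_words (Suc n)) k (3 * 6 ^ n)"
proof (induction n)
  case 0
  have "at_offset {[]} 1 i = (if i = 1 then {[]} else {})" for i
    by (auto simp: at_offset_def)
  \<comment> \<open>Interval 4 of level 1 is met at offsets 0, 1, 2 by the letters with digit sums
    4, 3, 2, of which there are 3, 6, 3.\<close>
  then have "rich (level_words (Suc 0)) 4 3"
    using card_at_offset_children_eq[of "{[]}" 1 1 0] card_at_offset_children_eq[of "{[]}" 1 1 1]
      card_at_offset_children_eq[of "{[]}" 1 1 2]
    by (simp add: rich_def level_words_Suc)
  then show ?case by auto
next
  case (Suc n)
  then obtain k where "rich (level_words (Suc n)) ((3 * k) div 3) (3 * 6 ^ n)" by auto
  from rich_children[OF finite_level_words this] show ?case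
    unfolding level_words_Suc[of "Suc n"] by (auto simp: mult_ac)
qed

text \<open>Prepares the union bound over all levels: 9 * 3^j counts three offsets for each of
  3^(j+1) descendants, and N r^j is the number of words guaranteed at each offset before the next
  step.\<close>

lemma superexponential_series_le_half:
  fixes a r :: real
  assumes "0 < a" "1 < r"
  obtains N where "1 \<le> N" "summable (\<lambda>j. 9 * 3 ^ j * exp (- a * (N * r ^ j)))"
    "(\<Sum>j. 9 * 3 ^ j * exp (- a * (N * r ^ j))) \<le> 1/2"
proof -
  \<comment> \<open>With Bernoulli's inequality r^j \<ge> 1 + j (r - 1), the two logarithmic bounds
    give exp(-a N r^j) \<le> 6^-j / 36, hence terms of at most 2^-j / 4, with total 1/2.\<close>
  define N where "N = Max {1, ln 36 / a, ln 6 / (a * (r - 1))}"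
  have N: "1 \<le> N" "ln 36 \<le> a * N" "ln 6 \<le> a * N * (r - 1)"
  proof -
    have "1 \<le> N" "ln 36 / a \<le> N" "ln 6 / (a * (r - 1)) \<le> N" by (simp_all add: N_def)
    then show "1 \<le> N" "ln 36 \<le> a * N" "ln 6 \<le> a * N * (r - 1)"
      using assms by (simp_all add: field_simps)
  qed
  have le: "9 * 3 ^ j * exp (- a * (N * r ^ j)) \<le> 1/4 * (1/2) ^ j" for j
  proof -
    have "1 + real j * (r - 1) \<le> r ^ j"
      using Bernoulli_inequality[of "r - 1" j] assms by simp
    then have "a * N * (1 + real j * (r - 1)) \<le> a * N * r ^ j"
      using assms N by (intro mult_left_mono) auto
    moreover have "real j * ln 6 \<le> real j * (a * N * (r - 1))"
      using N by (intro mult_left_mono) auto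
    ultimately have "ln 36 + real j * ln 6 \<le> a * N * r ^ j"
      using N by (simp add: algebra_simps)
    then have "exp (- a * (N * r ^ j)) \<le> exp (- (ln 36 + real j * ln 6))"
      by (simp add: mult.assoc)
    also have "\<dots> = 1/36 * (1/6) ^ j"
      unfolding exp_minus exp_add exp_of_nat_mult by (simp add: field_simps)
    finally have "9 * 3 ^ j * exp (- a * (N * r ^ j)) \<le> 9 * 3 ^ j * (1/36 * (1/6) ^ j)"
      by (intro mult_left_mono) auto
    also have "\<dots> = 1/4 * (3 * (1/6)) ^ j" by (subst power_mult_distrib) simp
    finally show ?thesis by simp
  qed
  have sums: "(\<lambda>j. 1/4 * (1/2::real) ^ j) sums (1/2)"
    using sums_mult[OF geometric_sums[of "1/2::real"], of "1/4"] by simp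
  show ?thesis
  proof
    show *: "summable (\<lambda>j. 9 * 3 ^ j * exp (- a * (N * r ^ j)))"
      by (rule summable_comparison_test'[OF sums_summable[OF sums]]) (use le in auto)
    show "(\<Sum>j. 9 * 3 ^ j * exp (- a * (N * r ^ j))) \<le> 1/2"
      using suminf_le[OF le * sums_summable[OF sums]] sums_unique[OF sums] by simp
  qed (fact N)
qed

section \<open>Richness survives the random labelling\<close>

context menger_percolation
begin

text \<open>Union bound over the 3 \<open>card D\<close> pairs of interval and offset. Each pair has
  at least 6 m candidate children by \<open>rich_children\<close>, so Hoeffding applies with
  exponent -2 c^2 (6 m).\<close>

lemma prob_poor_children:
  assumes S: "S \<subseteq> level_words n" "\<And>l. l \<in> D \<Longrightarrow> rich S (l div 3) m" and D: "finite D"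
    and c: "0 \<le> c" "c \<le> p" and m: "0 \<le> m"
  shows "prob {\<omega> \<in> space M. \<not> (\<forall>l\<in>D. rich {v \<in> children S. X v \<omega>} l (6 * (p - c) * m))}
    \<le> 3 * card D * exp (- 12 * c\<^sup>2 * m)"
proof -
  have finS: "finite S" using S(1) finite_level_words by (rule finite_subset)
  define C where "C x = at_offset (children S) (fst x) (snd x)" for x
  have fin: "finite (C x)" for x by (simp add: C_def finite_at_offset finite_children finS)
  have sub: "C x \<subseteq> menger_words" for x
    using children_subset[OF S(1)] level_words_subset[of "Suc n"] by (auto simp: C_def at_offset_def)
  define E where "E x = {\<omega> \<in> space M. real (card {v \<in> C x. X v \<omega>}) \<le> (p - c) * card (C x)}" for x
  have E_ev: "E x \<in> events" for x
    unfolding E_def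
  proof (rule events_labels[OF label_pred_finite[OF fin] sub])
    fix L L' :: "(real^3) list \<Rightarrow> bool"
    assume "\<And>w. w \<in> C x \<Longrightarrow> L w = L' w" and *: "real (card {v \<in> C x. L v}) \<le> (p - c) * card (C x)"
    then have "{v \<in> C x. L' v} = {v \<in> C x. L v}" by auto
    with * show "real (card {v \<in> C x. L' v}) \<le> (p - c) * card (C x)" by simp
  qed
  have big: "6 * m \<le> card (C (l, i))" if "l \<in> D" "i \<in> {0, 1, 2}" for l i
    using rich_children[OF finS S(2)[OF that(1)]] that by (auto simp: rich_def C_def)
  let ?I = "D \<times> {0, 1, 2::int}"
  have "prob {\<omega> \<in> space M. \<not> (\<forall>l\<in>D. rich {v \<in> children S. X v \<omega>} l (6 * (p - c) * m))}
      \<le> prob (\<Union>x\<in>?I. E x)"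
  proof (rule finite_measure_mono)
    show "{\<omega> \<in> space M. \<not> (\<forall>l\<in>D. rich {v \<in> children S. X v \<omega>} l (6 * (p - c) * m))} \<subseteq> (\<Union>x\<in>?I. E x)"
    proof
      fix \<omega> assume "\<omega> \<in> {\<omega> \<in> space M. \<not> (\<forall>l\<in>D. rich {v \<in> children S. X v \<omega>} l (6 * (p - c) * m))}"
      then obtain l i where *: "\<omega> \<in> space M" "l \<in> D" "i \<in> {0, 1, 2}"
        "real (card (at_offset {v \<in> children S. X v \<omega>} l i)) < 6 * (p - c) * m"
        unfolding rich_def mem_Collect_eq by (meson not_le)
      have "at_offset {v \<in> children S. X v \<omega>} l i = {v \<in> C (l, i). X v \<omega>}"
        by (auto simp: at_offset_def C_def)
      moreover have "6 * (p - c) * m \<le> (p - c) * card (C (l, i))"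
        using mult_left_mono[OF big[OF *(2,3)], of "p - c"] c by (simp add: mult_ac)
      ultimately have "\<omega> \<in> E (l, i)" using * by (simp add: E_def)
      with * show "\<omega> \<in> (\<Union>x\<in>?I. E x)" by blast
    qed
    show "(\<Union>x\<in>?I. E x) \<in> events" using D E_ev by (intro sets.finite_UN) auto
  qed
  also have "\<dots> \<le> (\<Sum>x\<in>?I. prob (E x))"
    using D E_ev by (intro finite_measure_subadditive_finite) auto
  also have "\<dots> \<le> (\<Sum>x\<in>?I. exp (- 12 * c\<^sup>2 * m))"
  proof (rule sum_mono)
    fix x assume "x \<in> ?I"
    then have "6 * m \<le> card (C x)" using big by (cases x) auto
    then have "2 * c\<^sup>2 * (6 * m) \<le> 2 * c\<^sup>2 * card (C x)" by (intro mult_left_mono) auto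
    then have "exp (- 2 * c\<^sup>2 * card (C x)) \<le> exp (- 12 * c\<^sup>2 * m)" by simp
    with prob_few_labels[OF fin sub c(1), of x] show "prob (E x) \<le> exp (- 12 * c\<^sup>2 * m)"
      unfolding E_def by linarith
  qed
  also have "\<dots> = 3 * card D * exp (- 12 * c\<^sup>2 * m)"
    by (simp add: card_cartesian_product)
  finally show ?thesis .
qed

text \<open>Split by the value S of the retained set at level n: Q and this value depend on labels
  of length at most n, while the next step uses fresh labels. Carrying Q along makes the error
  proportional to the probability of Q, so it stays useful when Q is rare.\<close>

lemma prob_rich_then_poor:
  assumes Q: "label_pred (short_words n) Q" and D': "finite D'" "\<And>l. l \<in> D' \<Longrightarrow> l div 3 \<in> D"
    and c: "0 \<le> c" "c \<le> p" and m: "0 \<le> m"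
  shows "prob {\<omega> \<in> space M. Q (\<lambda>w. X w \<omega>) \<and> (\<forall>l\<in>D. rich (retained (\<lambda>w. X w \<omega>) n) l m) \<and>
      \<not> (\<forall>l\<in>D'. rich (retained (\<lambda>w. X w \<omega>) (Suc n)) l (6 * (p - c) * m))}
    \<le> 3 * card D' * exp (- 12 * c\<^sup>2 * m) * prob {\<omega> \<in> space M. Q (\<lambda>w. X w \<omega>)}"
proof -
  let ?\<delta> = "3 * card D' * exp (- 12 * c\<^sup>2 * m)"
  define G where "G = {S \<in> Pow (level_words n). \<forall>l\<in>D. rich S l m}"
  have finG: "finite G" by (simp add: G_def)
  define A where "A S L \<longleftrightarrow> Q L \<and> retained L n = S" for S L
  define E where "E S L \<longleftrightarrow> \<not> (\<forall>l\<in>D'. rich {v \<in> children S. L v} l (6 * (p - c) * m))" for S L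
  have A: "label_pred (short_words n) (A S)" for S
    unfolding A_def by (intro label_pred_conj Q label_pred_retained)
  have E: "label_pred (level_words (Suc n)) (E S)" if "S \<in> G" for S
  proof (rule label_pred_finite[OF finite_level_words])
    fix L L' :: "(real^3) list \<Rightarrow> bool"
    assume "\<And>w. w \<in> level_words (Suc n) \<Longrightarrow> L w = L' w" and *: "E S L"
    then have "{v \<in> children S. L' v} = {v \<in> children S. L v}"
      using children_subset[of S n] that unfolding G_def by blast
    with * show "E S L'" by (simp add: E_def)
  qed
  have A_ev: "{\<omega> \<in> space M. A S (\<lambda>w. X w \<omega>)} \<in> events" for S
    by (rule events_labels[OF A short_words_subset])
  have AE_ev: "{\<omega> \<in> space M. A S (\<lambda>w. X w \<omega>) \<and> E S (\<lambda>w. X w \<omega>)} \<in> events" if "S \<in> G" for S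
    using A_ev events_labels[OF E[OF that] level_words_subset] by (intro sets.sets_Collect_conj) auto
  have "{\<omega> \<in> space M. Q (\<lambda>w. X w \<omega>) \<and> (\<forall>l\<in>D. rich (retained (\<lambda>w. X w \<omega>) n) l m) \<and>
      \<not> (\<forall>l\<in>D'. rich (retained (\<lambda>w. X w \<omega>) (Suc n)) l (6 * (p - c) * m))} =
      (\<Union>S\<in>G. {\<omega> \<in> space M. A S (\<lambda>w. X w \<omega>) \<and> E S (\<lambda>w. X w \<omega>)})"
    using retained_subset by (auto simp: G_def A_def E_def retained_Suc)
  then have "prob {\<omega> \<in> space M. Q (\<lambda>w. X w \<omega>) \<and> (\<forall>l\<in>D. rich (retained (\<lambda>w. X w \<omega>) n) l m) \<and>
      \<not> (\<forall>l\<in>D'. rich (retained (\<lambda>w. X w \<omega>) (Suc n)) l (6 * (p - c) * m))}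
      \<le> (\<Sum>S\<in>G. prob {\<omega> \<in> space M. A S (\<lambda>w. X w \<omega>) \<and> E S (\<lambda>w. X w \<omega>)})"
    using finG AE_ev by (simp only:) (intro finite_measure_subadditive_finite, auto)
  also have "\<dots> \<le> (\<Sum>S\<in>G. ?\<delta> * prob {\<omega> \<in> space M. A S (\<lambda>w. X w \<omega>)})"
  proof (rule sum_mono)
    fix S assume S: "S \<in> G"
    have "prob {\<omega> \<in> space M. A S (\<lambda>w. X w \<omega>) \<and> E S (\<lambda>w. X w \<omega>)} =
        prob {\<omega> \<in> space M. A S (\<lambda>w. X w \<omega>)} * prob {\<omega> \<in> space M. E S (\<lambda>w. X w \<omega>)}"
      by (rule prob_two_blocks[OF A E[OF S] short_words_subset level_words_subset short_words_disjoint]) simp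
    also have "\<dots> \<le> prob {\<omega> \<in> space M. A S (\<lambda>w. X w \<omega>)} * ?\<delta>"
      unfolding E_def using S D' c m by (intro mult_left_mono prob_poor_children) (auto simp: G_def)
    finally show "prob {\<omega> \<in> space M. A S (\<lambda>w. X w \<omega>) \<and> E S (\<lambda>w. X w \<omega>)} \<le> ?\<delta> * prob {\<omega> \<in> space M. A S (\<lambda>w. X w \<omega>)}"
      by (simp add: mult.commute)
  qed
  also have "\<dots> = ?\<delta> * (\<Sum>S\<in>G. prob {\<omega> \<in> space M. A S (\<lambda>w. X w \<omega>)})"
    by (simp add: sum_distrib_left)
  also have "(\<Sum>S\<in>G. prob {\<omega> \<in> space M. A S (\<lambda>w. X w \<omega>)}) = prob (\<Union>S\<in>G. {\<omega> \<in> space M. A S (\<lambda>w. X w \<omega>)})"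
    using finG A_ev by (intro finite_measure_finite_Union[symmetric]) (auto simp: disjoint_family_on_def A_def)
  also have "\<dots> \<le> prob {\<omega> \<in> space M. Q (\<lambda>w. X w \<omega>)}"
    by (intro finite_measure_mono events_labels[OF Q short_words_subset]) (auto simp: A_def)
  finally show ?thesis by (simp add: mult_left_mono)
qed

text \<open>With positive probability all words up to level \<open>n\<^sub>0\<close> have label 1,
  which makes \<open>k\<^sub>0\<close> rich. Given this, the probability that some descendant ever
  falls below the threshold \<open>N * r ^ j\<close> is at most 1/2.\<close>

lemma prob_persistently_covered_pos:
  assumes "p > 1/6"
  shows "0 < prob {\<omega> \<in> space M. \<exists>n\<^sub>0 k\<^sub>0. persistently_covered (\<lambda>w. X w \<omega>) n\<^sub>0 k\<^sub>0}"
proof -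
  \<comment> \<open>Giving up half of the gap leaves r = 3 p + 1/2, still above 1.\<close>
  define c where "c = (p - 1/6) / 2"
  define r where "r = 6 * (p - c)"
  have c: "0 < c" "c \<le> p" and r: "1 < r" using assms p by (simp_all add: c_def r_def field_simps)
  obtain N where N: "1 \<le> N" and summ: "summable (\<lambda>j. 9 * 3 ^ j * exp (- (12 * c\<^sup>2) * (N * r ^ j)))"
    and small: "(\<Sum>j. 9 * 3 ^ j * exp (- (12 * c\<^sup>2) * (N * r ^ j))) \<le> 1/2"
    using superexponential_series_le_half[of "12 * c\<^sup>2" r] c r by auto
  obtain n where n: "N < 6 ^ n" using real_arch_pow[of 6 N] by auto
  obtain k\<^sub>0 where k\<^sub>0: "rich (level_words (Suc n)) k\<^sub>0 (3 * 6 ^ n)" using rich_level_words by blast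
  define n\<^sub>0 where "n\<^sub>0 = Suc n"
  define Q where "Q L \<longleftrightarrow> (\<forall>w\<in>short_words n\<^sub>0. L w)" for L :: "(real^3) list \<Rightarrow> bool"
  have Q: "label_pred (short_words (n\<^sub>0 + j)) Q" for j
    unfolding Q_def[abs_def] by (intro label_pred_ball[OF finite_short_words] label_pred_label) (auto simp: short_words_def)
  let ?Q = "{\<omega> \<in> space M. Q (\<lambda>w. X w \<omega>)}"
  have Q_pos: "0 < prob ?Q"
    using p by (simp add: Q_def prob_all_labels short_words_subset)
  define R where "R j L \<longleftrightarrow> (\<forall>l\<in>descendants j k\<^sub>0. rich (retained L (n\<^sub>0 + j)) l (N * r ^ j))" for j L
  have R0: "R 0 L" if "Q L" for L
  proof -
    have "retained L n\<^sub>0 = retained (\<lambda>_. True) n\<^sub>0"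
      using that by (intro retained_cong) (simp add: Q_def)
    also have "\<dots> = level_words n\<^sub>0" by (simp add: retained_def level_words_def)
    finally show ?thesis
      using k\<^sub>0 n N unfolding R_def by (force simp: descendants_def rich_def n\<^sub>0_def)
  qed
  have R: "label_pred menger_words (R j)" for j
    unfolding R_def[abs_def] by (rule label_pred_retained')
  have Q': "label_pred menger_words Q"
    by (rule label_pred_mono[OF Q[of 0] short_words_subset])
  define B where "B j = {\<omega> \<in> space M. Q (\<lambda>w. X w \<omega>) \<and> R j (\<lambda>w. X w \<omega>) \<and> \<not> R (Suc j) (\<lambda>w. X w \<omega>)}" for j
  have B_ev: "B j \<in> events" for j
    unfolding B_def by (rule events_labels[OF label_pred_conj[OF Q' label_pred_conj[OF R label_pred_not[OF R]]]]) simp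
  have prob_B: "prob (B j) \<le> 9 * 3 ^ j * exp (- (12 * c\<^sup>2) * (N * r ^ j)) * prob ?Q" for j
    using prob_rich_then_poor[OF Q[of j], of "descendants (Suc j) k\<^sub>0" "descendants j k\<^sub>0" c "N * r ^ j"]
      c r N descendants_Suc[of _ j k\<^sub>0]
    by (simp add: B_def R_def card_descendants r_def mult_ac)
  let ?Z = "{\<omega> \<in> space M. Q (\<lambda>w. X w \<omega>) \<and> (\<forall>j. R j (\<lambda>w. X w \<omega>))}"
  have Z_ev: "?Z \<in> events"
    by (rule events_labels[OF label_pred_conj[OF Q' label_pred_all[OF R]]]) simp
  \<comment> \<open>As \<open>R 0\<close> holds on Q, either every \<open>R j\<close> holds or
    richness is lost at some step j, which is the event \<open>B j\<close>.\<close>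
  have "?Q \<subseteq> ?Z \<union> (\<Union>j. B j)"
  proof
    fix \<omega> assume \<omega>: "\<omega> \<in> ?Q"
    show "\<omega> \<in> ?Z \<union> (\<Union>j. B j)"
    proof (rule ccontr)
      assume "\<omega> \<notin> ?Z \<union> (\<Union>j. B j)"
      with \<omega> have step: "R j (\<lambda>w. X w \<omega>) \<Longrightarrow> R (Suc j) (\<lambda>w. X w \<omega>)"
        and "\<not> (\<forall>j. R j (\<lambda>w. X w \<omega>))" for j by (auto simp: B_def)
      moreover have "R j (\<lambda>w. X w \<omega>)" for j using \<omega> R0 step by (induction j) auto
      ultimately show False by blast
    qed
  qed
  then have "prob ?Q \<le> prob (?Z \<union> (\<Union>j. B j))"
    using Z_ev B_ev by (intro finite_measure_mono) auto
  also have "\<dots> \<le> prob ?Z + prob (\<Union>j. B j)"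
    using Z_ev B_ev by (intro measure_Un_le) auto
  also have "prob (\<Union>j. B j) \<le> (\<Sum>j. 9 * 3 ^ j * exp (- (12 * c\<^sup>2) * (N * r ^ j)) * prob ?Q)"
  proof -
    have s: "summable (\<lambda>j. prob (B j))"
      by (rule summable_comparison_test'[OF summable_mult2[OF summ]]) (use prob_B in auto)
    have "prob (\<Union>j. B j) \<le> (\<Sum>j. prob (B j))"
      using B_ev by (intro finite_measure_subadditive_countably s) auto
    also have "\<dots> \<le> (\<Sum>j. 9 * 3 ^ j * exp (- (12 * c\<^sup>2) * (N * r ^ j)) * prob ?Q)"
      by (intro suminf_le prob_B s summable_mult2 summ)
    finally show ?thesis .
  qed
  also have "\<dots> \<le> 1/2 * prob ?Q"
    unfolding suminf_mult2[OF summ, symmetric] using small by (intro mult_right_mono) auto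
  finally have "0 < prob ?Z" using Q_pos by simp
  also have "prob ?Z \<le> prob {\<omega> \<in> space M. \<exists>n\<^sub>0 k\<^sub>0. persistently_covered (\<lambda>w. X w \<omega>) n\<^sub>0 k\<^sub>0}"
  proof (rule finite_measure_mono)
    show "{\<omega> \<in> space M. \<exists>n\<^sub>0 k\<^sub>0. persistently_covered (\<lambda>w. X w \<omega>) n\<^sub>0 k\<^sub>0} \<in> events"
      by (rule events_labels[OF label_pred_persistently_covered]) simp
    have "persistently_covered L n\<^sub>0 k\<^sub>0" if "\<And>j. R j L" for L
      unfolding persistently_covered_def
    proof (intro allI impI)
      fix n k assume n: "n\<^sub>0 \<le> n" and k: "k div 3 ^ (n - n\<^sub>0) = k\<^sub>0"
      have "rich (retained L n) k (N * r ^ (n - n\<^sub>0))"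
        using that[of "n - n\<^sub>0"] n k by (simp add: R_def mem_descendants_iff)
      moreover have "0 < N * r ^ (n - n\<^sub>0)" using N r by simp
      ultimately have "0 < real (card (at_offset (retained L n) k 0))" by (simp add: rich_def)
      then have "at_offset (retained L n) k 0 \<noteq> {}" by auto
      then show "covered L n k" by (auto simp: covered_def at_offset_def)
    qed
    then show "?Z \<subseteq> {\<omega> \<in> space M. \<exists>n\<^sub>0 k\<^sub>0. persistently_covered (\<lambda>w. X w \<omega>) n\<^sub>0 k\<^sub>0}" by blast
  qed
  finally show ?thesis .
qed

lemma AE_contains_interval:
  assumes "p > 1/6"
  shows "AE \<omega> in M. non_extinction (\<lambda>w. X w \<omega>) \<longrightarrow>
    contains_interval (proj111 ` menger_sponge (\<lambda>w. X w \<omega>))"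
  using AE_persistently_covered[OF prob_persistently_covered_pos[OF assms]]
  by eventually_elim (auto dest: contains_interval_if_persistently_covered)

end

subsection \<open>The subcritical case\<close>

context menger_percolation
begin

lemma prob_mem_retained:
  assumes "w \<in> level_words n"
  shows "prob {\<omega> \<in> space M. w \<in> retained (\<lambda>w. X w \<omega>) n} = p ^ n"
proof -
  have w: "w \<in> lists menger_T" "length w = n" using assms by (auto simp: level_words_def)
  let ?W = "(\<lambda>k. take k w) ` {1..n}"
  \<comment> \<open>Prefixes of different lengths are different words, so exactly n labels are
    involved.\<close>
  have "inj_on (\<lambda>k. take k w) {1..n}"
    by (rule inj_on_inverseI[where g = length]) (simp add: w)
  then have "card ?W = n" by (simp add: card_image)
  moreover have "?W \<subseteq> menger_words"
    using w by (force simp: menger_words_def dest: in_set_takeD)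
  ultimately have "prob {\<omega> \<in> space M. \<forall>v\<in>?W. X v \<omega>} = p ^ n"
    using prob_all_labels[of ?W] by simp
  moreover have "w \<in> retained L n \<longleftrightarrow> (\<forall>v\<in>?W. L v)" for L
    using w by (auto simp: retained_def)
  ultimately show ?thesis by simp
qed

end

text \<open>The two interior offsets carry the block with eigenvalue 6; a large weight \<open>\<alpha>\<close> on them
  absorbs their contribution to the two end offsets.\<close>

definition boundary_weight :: "real \<Rightarrow> (real^3) list set \<Rightarrow> int \<Rightarrow> real" where
  "boundary_weight \<alpha> S k = real (card (at_offset S k 0)) + real (card (at_offset S k 3))
     + \<alpha> * (real (card (at_offset S k 1)) + real (card (at_offset S k 2)))"

text \<open>If a and b count the end and interior offsets, the children have counts a + 7 b and 6 b.
  Against the weight \<alpha> b the extra 7 b costs only 7 / \<alpha> in the factor.\<close>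

lemma boundary_weight_children:
  assumes "finite S" "0 < \<alpha>"
  shows "boundary_weight \<alpha> (children S) (3 * k) \<le> (6 + 7 / \<alpha>) * boundary_weight \<alpha> S k"
proof -
  define a b where "a = real (card (at_offset S k 0)) + card (at_offset S k 3)"
    and "b = real (card (at_offset S k 1)) + card (at_offset S k 2)"
  have "boundary_weight \<alpha> (children S) (3 * k) = a + (6 * \<alpha> + 7) * b"
    unfolding boundary_weight_def card_boundary_children[OF assms(1)] a_def b_def
    by (simp add: algebra_simps)
  also have "\<dots> \<le> (6 + 7 / \<alpha>) * (a + \<alpha> * b)"
    using assms(2) by (simp add: field_simps a_def)
  finally show ?thesis by (simp add: boundary_weight_def a_def b_def)
qed

lemma card_offsets_le_boundary_weight:
  assumes "finite S" "1 \<le> \<alpha>"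
  shows "card {w \<in> S. k - addr w \<in> {0..3}} \<le> boundary_weight \<alpha> S k"
proof -
  have eq: "{w \<in> S. k - addr w \<in> {0..3}} =
      at_offset S k 0 \<union> at_offset S k 3 \<union> (at_offset S k 1 \<union> at_offset S k 2)"
    by (auto simp: at_offset_def)
  have "card {w \<in> S. k - addr w \<in> {0..3}} \<le>
      card (at_offset S k 0) + card (at_offset S k 3) + (card (at_offset S k 1) + card (at_offset S k 2))"
    unfolding eq by (meson add_mono card_Un_le le_trans)
  then have "real (card {w \<in> S. k - addr w \<in> {0..3}}) \<le>
      card (at_offset S k 0) + card (at_offset S k 3) + (card (at_offset S k 1) + card (at_offset S k 2))"
    by (simp flip: of_nat_add)
  also have "\<dots> \<le> boundary_weight \<alpha> S k"
    using mult_right_mono[OF assms(2), of "real (card (at_offset S k 1)) + card (at_offset S k 2)"]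
    by (simp add: boundary_weight_def)
  finally show ?thesis .
qed

lemma interval_contains_triadic:
  assumes "contains_interval S"
  obtains m :: nat and k :: int where "of_int k / 3 ^ m \<in> S"
proof -
  obtain I x y where I: "is_interval I" "x \<in> I" "y \<in> I" "x < y" "I \<subseteq> S"
    using assms by (auto simp: contains_interval_def)
  obtain m where m: "(1/3) ^ m < y - x"
    using real_arch_pow_inv[of "y - x" "1/3"] I(4) by auto
  \<comment> \<open>Rounding x up at a level with mesh below y - x stays within the
    interval.\<close>
  define k where "k = \<lceil>3 ^ m * x\<rceil>"
  have "x \<le> of_int k / 3 ^ m" by (simp add: k_def field_simps)
  moreover have "of_int k \<le> 3 ^ m * x + 1" unfolding k_def by linarith
  then have "of_int k / 3 ^ m \<le> x + (1/3) ^ m" by (simp add: field_simps power_divide)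
  with m have "of_int k / 3 ^ m \<le> y" by linarith
  ultimately have "of_int k / 3 ^ m \<in> I" using I by (meson mem_is_interval_1_I)
  with I that show thesis by blast
qed

section \<open>Triadic points are almost surely missed\<close>

context menger_percolation
begin

text \<open>First moment bound: the point has index \<open>3 ^ j * k\<close> at level m + j, and the
  expected number of retained words covering it there is at most p^m c r^j with r < 1.\<close>

lemma AE_triadic_not_mem:
  assumes "p < 1/6"
  shows "AE \<omega> in M. of_int k / 3 ^ m \<notin> proj111 ` menger_sponge (\<lambda>w. X w \<omega>)"
proof -
  let ?y = "of_int k / 3 ^ m :: real"
  \<comment> \<open>Ensures 7 p < \<alpha> (1 - 6 p), that is r < 1; the 8 gives strictness, and the
    maximum with 1 serves \<open>card_offsets_le_boundary_weight\<close>.\<close>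
  define \<alpha> where "\<alpha> = max 1 (8 * p / (1 - 6 * p))"
  define r where "r = p * (6 + 7 / \<alpha>)"
  have \<alpha>: "1 \<le> \<alpha>" by (simp add: \<alpha>_def)
  have "8 * p / (1 - 6 * p) \<le> \<alpha>" by (simp add: \<alpha>_def)
  then have "8 * p \<le> \<alpha> * (1 - 6 * p)" using assms by (simp add: field_simps)
  then have "7 * p < \<alpha> * (1 - 6 * p)" using p by linarith
  then have r: "0 < r" "r < 1"
    using p \<alpha> by (simp_all add: r_def field_simps add_pos_pos)
  define c where "c = boundary_weight \<alpha> (level_words m) k"
  have weight: "boundary_weight \<alpha> (level_words (m + j)) (3 ^ j * k) \<le> (6 + 7 / \<alpha>) ^ j * c" for j
  proof (induction j)
    case (Suc j)
    have "boundary_weight \<alpha> (level_words (m + Suc j)) (3 ^ Suc j * k) \<le>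
        (6 + 7 / \<alpha>) * boundary_weight \<alpha> (level_words (m + j)) (3 ^ j * k)"
      using boundary_weight_children[OF finite_level_words, of \<alpha> "m + j" "3 ^ j * k"] \<alpha>
      by (simp add: level_words_Suc mult.assoc)
    also have "\<dots> \<le> (6 + 7 / \<alpha>) * ((6 + 7 / \<alpha>) ^ j * c)"
      using Suc \<alpha> by (intro mult_left_mono) auto
    finally show ?case by simp
  qed (simp add: c_def)
  define C where "C j = {w \<in> level_words (m + j). 3 ^ j * k - addr w \<in> {0..3}}" for j
  define E where "E j = {\<omega> \<in> space M. \<exists>w\<in>C j. w \<in> retained (\<lambda>w. X w \<omega>) (m + j)}" for j
  have fin: "finite (C j)" for j by (simp add: C_def)
  have E_ev: "E j \<in> events" for j
    unfolding E_def by (rule events_labels[OF label_pred_retained' order_refl])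
  have prob_E: "prob (E j) \<le> p ^ m * c * r ^ j" for j
  proof -
    have E_eq: "E j = (\<Union>w\<in>C j. {\<omega> \<in> space M. w \<in> retained (\<lambda>w. X w \<omega>) (m + j)})"
      by (auto simp: E_def)
    have "prob (E j) \<le> (\<Sum>w\<in>C j. prob {\<omega> \<in> space M. w \<in> retained (\<lambda>w. X w \<omega>) (m + j)})"
      unfolding E_eq using fin events_labels[OF label_pred_retained' order_refl]
      by (intro finite_measure_subadditive_finite) auto
    also have "\<dots> = p ^ (m + j) * card (C j)"
      by (simp add: prob_mem_retained C_def)
    also have "\<dots> \<le> p ^ (m + j) * ((6 + 7 / \<alpha>) ^ j * c)"
      using card_offsets_le_boundary_weight[OF finite_level_words \<alpha>] weight p
      unfolding C_def by (intro mult_left_mono order_trans[OF _ weight]) auto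
    also have "\<dots> = p ^ m * c * r ^ j"
      by (simp add: r_def power_add power_mult_distrib mult_ac)
    finally show ?thesis .
  qed
  have "(\<lambda>j. p ^ m * c * r ^ j) \<longlonglongrightarrow> p ^ m * c * 0"
    using r by (intro tendsto_intros LIMSEQ_power_zero) auto
  moreover have "prob (\<Inter>j. E j) \<le> p ^ m * c * r ^ j" for j
    using finite_measure_mono[OF _ E_ev[of j], of "\<Inter>j. E j"] prob_E[of j] by force
  ultimately have "prob (\<Inter>j. E j) \<le> p ^ m * c * 0" by (intro LIMSEQ_le_const) auto
  then have "prob (\<Inter>j. E j) = 0" by (simp add: order_antisym)
  then have "AE \<omega> in M. \<omega> \<notin> (\<Inter>j. E j)"
    using E_ev by (intro AE_not_in) (auto simp: null_sets_def emeasure_eq_measure)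
  moreover have "\<omega> \<in> (\<Inter>j. E j)"
    if \<omega>: "\<omega> \<in> space M" "?y \<in> proj111 ` menger_sponge (\<lambda>w. X w \<omega>)" for \<omega>
  proof
    fix j
    obtain x where x: "?y = proj111 x" "x \<in> menger_sponge (\<lambda>w. X w \<omega>)" using \<omega>(2) by blast
    have "\<exists>w\<in>retained (\<lambda>w. X w \<omega>) (m + j). x \<in> menger_word_map w ` cbox 0 1"
    \<comment> \<open>The sponge is an intersection over n \<ge> 1, so level 0 is recovered from
      level 1, whose cylinders lie in the unit cube.\<close>
    proof (cases "m + j = 0")
      case True
      from x(2) obtain w where w: "w \<in> retained (\<lambda>w. X w \<omega>) 1" "x \<in> menger_word_map w ` cbox 0 1"
        unfolding menger_sponge_def by (auto dest: bspec[of _ _ 1])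
      then have "x \<in> cbox 0 1"
        using menger_map_cbox by (auto simp: retained_Suc children_def menger_word_map_Cons)
      with True show ?thesis by simp
    next
      case False
      with x(2) show ?thesis unfolding menger_sponge_def by fastforce
    qed
    then obtain w where w: "w \<in> retained (\<lambda>w. X w \<omega>) (m + j)" "?y \<in> proj111 ` menger_word_map w ` cbox 0 1"
      using x(1) by blast
    have w': "w \<in> lists menger_T" "length w = m + j" using w(1) by (auto simp: retained_def)
    have "3 ^ length w * ?y - of_int (addr w) = of_int (3 ^ j * k - addr w)"
      by (simp add: w' power_add)
    with w(2) have "of_int (3 ^ j * k - addr w) \<in> {0..3::real}"
      using mem_proj111_cylinder_iff[OF w'(1)] by simp
    then have "3 ^ j * k - addr w \<in> {0..3}"
      by (simp only: atLeastAtMost_iff of_int_0_le_iff of_int_le_numeral_iff)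
    then have "w \<in> C j" using w' by (auto simp: C_def level_words_def)
    with w(1) \<omega>(1) show "\<omega> \<in> E j" by (auto simp: E_def)
  qed
  ultimately show ?thesis by (elim AE_mp) auto
qed

text \<open>Every interval contains one of the countably many triadic points, so the exceptional
  null sets can be united.\<close>

lemma AE_not_contains_interval:
  assumes "p < 1/6"
  shows "AE \<omega> in M. \<not> contains_interval (proj111 ` menger_sponge (\<lambda>w. X w \<omega>))"
proof -
  have "AE \<omega> in M. \<forall>m k. of_int k / 3 ^ m \<notin> proj111 ` menger_sponge (\<lambda>w. X w \<omega>)"
    unfolding AE_all_countable using AE_triadic_not_mem[OF assms] by blast
  then show ?thesis by eventually_elim (metis interval_contains_triadic)
qed

end

theorem theorem1p18:
  fixes M :: "'a measure"
    and X :: "(real^3) list \<Rightarrow> 'a \<Rightarrow> bool"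
    and p :: real
  assumes "prob_space M"
    and "0 < p" and "p < 1"
    and "prob_space.indep_vars M (\<lambda>_. count_space UNIV) X menger_words"
    and "\<And>w. w \<in> menger_words \<Longrightarrow>
           distr M (count_space UNIV) (X w) = measure_pmf (bernoulli_pmf p)"
  shows "(p > 1/6 \<longrightarrow>
            (AE \<omega> in M. non_extinction (\<lambda>w. X w \<omega>) \<longrightarrow>
               contains_interval (proj111 ` menger_sponge (\<lambda>w. X w \<omega>))))
       \<and> (p < 1/6 \<longrightarrow>
            (AE \<omega> in M.
               \<not> contains_interval (proj111 ` menger_sponge (\<lambda>w. X w \<omega>))))"
proof -
  interpret prob_space M by fact
  interpret menger_percolation M X p by unfold_locales (use assms in auto)
  show ?thesis using AE_contains_interval AE_not_contains_interval by blast
qed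

end
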